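(* Let $m\ge 2$ be an integer and let $\mathcal W$ be a win distribution with the following three properties. (1) Negatively associated: for every $n\ge1$ and $\mathbf x\sim\mathcal W$, the variables $\mathbf x_1,\dots,\mathbf x_n$ are negatively associated. (2) Shift-invariant: for every $n\ge1$, the distribution of $(\mathbf x_1,\mathbf x_2,\dots)$ equals that of $(\mathbf x_n,\mathbf x_{n+1},\dots)$. (3) Sufficiently small: for each $r\in\{1,\dots,m-1\}$ let $\mathbf w^{(r)}:=1-\prod_{\ell=1}^r(1-\mathbf x_\ell)$ with $\mathbf x\sim\mathcal W$. Then for every $r\in\{1,\dots,m-1\}$ and every $t\in[0,1]$, $$\mathbb E\big[(\mathbf w^{(r)}-t)_+\big]\le 1-t-\frac{m-r}{m}\Big(1-t^{\frac{m}{m-r}}\Big).$$ Then there exists a tournament subroutine $\mathcal T$ for which $\mathrm{OCS}_{\mathcal W,\mathcal T}$ is an $(F,m)$-discrete OCS, where $$F(n):=\mathbb E_{\mathbf x\sim\mathcal W}\Big[\prod_{\ell=1}^n(1-\mathbf x_\ell)\Big].$$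
   Context: $(z)_+=\max(z,0)$. A win distribution is a probability distribution $\mathcal W$ over infinite sequences $(\mathbf x_1,\mathbf x_2,\dots)\in[0,1]^{\mathbb N}$. Random variables $\mathbf x_1,\dots,\mathbf x_n$ are negatively associated if, for every pair of disjoint $A_1,A_2\subseteq[n]$ and all nondecreasing functions $f_1,f_2$, we have $\mathrm{Cov}[f_1(\mathbf x_{A_1}),f_2(\mathbf x_{A_2})]\le0$. Here $\mathbf x_A$ is the subvector indexed by $A$. Fix a ground set $L$. An $m$-discrete OCS is an online randomized algorithm that at each time step $j=1,2,\dots$ receives a size-$m$ multiset $A_j$ of elements of $L$ and irrevocably selects one winner from $A_j$. A set of time steps is consecutive if it is $\{j_1,\dots,j_2\}$ with $j_1<j_2$. $\mathrm{count}_i(S)$ is the total multiplicity of $i$ in the $A_j$, $j\in S$. An $(F,m)$-discrete OCS is an $m$-discrete OCS such that for any element $i$ and pairwise disjoint consecutive sets of time steps $S_1,\dots,S_k$, the probability that $i$ never wins at a step in $\bigcup_\ell S_\ell$ is at most $\prod_{\ell}F(\mathrm{count}_i(S_\ell))$. A tournament subroutine $\mathcal T$ is a (possibly randomized, using fresh randomness each round) rule that, given a round's multiset $A_j$, the multiplicities $r_j(i)$ and the desired win probabilities $\mathbf w_j(i)$ ($i\in A_j$), selects one winner $i\in A_j$. $\mathrm{OCS}_{\mathcal W,\mathcal T}$ is the following $m$-discrete OCS. - Initialization: for each $i\in L$ independently draw $\mathbf x(i)=(\mathbf x_1(i),\mathbf x_2(i),\dots)\sim\mathcal W$, and set $k_1(i)=1$.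 - Upon receiving $A_j$: for each $i$ let $r_j(i)$ be its multiplicity in $A_j$, and set $$\mathbf w_j(i)=1-\prod_{\ell=0}^{r_j(i)-1}\big(1-\mathbf x_{k_j(i)+\ell}(i)\big).$$ - Use $\mathcal T$ to select the winner. - Set $k_{j+1}(i)=k_j(i)+r_j(i)$ for every $i\in L$. *)

theory Defs
  imports "HOL-Probability.Probability" "HOL-Library.Multiset"
begin

(* Sequence indices and time steps are natural numbers starting at 0: the mathematical
   x_1, x_2, ... is x 0, x 1, ..., and the first time step is 0. *)

section \<open>Negative association\<close>

definition covariance :: "'a measure \<Rightarrow> ('a \<Rightarrow> real) \<Rightarrow> ('a \<Rightarrow> real) \<Rightarrow> real" where
  "covariance M Y Z =
     (\<integral>\<omega>. (Y \<omega> - (\<integral>\<omega>'. Y \<omega>' \<partial>M)) * (Z \<omega> - (\<integral>\<omega>'. Z \<omega>' \<partial>M)) \<partial>M)"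

(* The test functions range over the nondecreasing (in the componentwise order) Borel functions
   for which the covariance exists.  If the variables take values in a bounded interval, as in
   a win distribution, the integrability conditions hold for all nondecreasing Borel functions. *)
definition negatively_associated :: "'a measure \<Rightarrow> ('i \<Rightarrow> 'a \<Rightarrow> real) \<Rightarrow> 'i set \<Rightarrow> bool" where
  "negatively_associated M X I \<longleftrightarrow>
     (\<forall>A1 A2 f1 f2.
        A1 \<subseteq> I \<and> A2 \<subseteq> I \<and> A1 \<inter> A2 = {} \<and>
        f1 \<in> borel_measurable (Pi\<^sub>M A1 (\<lambda>_. borel)) \<and>
        f2 \<in> borel_measurable (Pi\<^sub>M A2 (\<lambda>_. borel)) \<and>
        mono_on (space (Pi\<^sub>M A1 (\<lambda>_. borel :: real measure))) f1 \<and>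
        mono_on (space (Pi\<^sub>M A2 (\<lambda>_. borel :: real measure))) f2 \<and>
        integrable M (\<lambda>\<omega>. f1 (\<lambda>i\<in>A1. X i \<omega>)) \<and>
        integrable M (\<lambda>\<omega>. f2 (\<lambda>i\<in>A2. X i \<omega>)) \<and>
        integrable M (\<lambda>\<omega>. f1 (\<lambda>i\<in>A1. X i \<omega>) * f2 (\<lambda>i\<in>A2. X i \<omega>))
        \<longrightarrow> covariance M (\<lambda>\<omega>. f1 (\<lambda>i\<in>A1. X i \<omega>)) (\<lambda>\<omega>. f2 (\<lambda>i\<in>A2. X i \<omega>)) \<le> (0::real))"

section \<open>Win distributions\<close>

abbreviation unit_interval :: "real measure" where
  "unit_interval \<equiv> restrict_space borel {0..1}"

definition win_distribution :: "(nat \<Rightarrow> real) measure \<Rightarrow> bool" where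
  "win_distribution W \<longleftrightarrow>
     prob_space W \<and> sets W = sets (Pi\<^sub>M (UNIV :: nat set) (\<lambda>_. unit_interval))"

definition shift_invariant :: "(nat \<Rightarrow> real) measure \<Rightarrow> bool" where
  "shift_invariant W \<longleftrightarrow> (\<forall>n. distr W W (\<lambda>x k. x (n + k)) = W)"

definition win_prob :: "nat \<Rightarrow> (nat \<Rightarrow> real) \<Rightarrow> real" where
  "win_prob r x = 1 - (\<Prod>l<r. (1 - x l))"

definition sufficiently_small :: "nat \<Rightarrow> (nat \<Rightarrow> real) measure \<Rightarrow> bool" where
  "sufficiently_small m W \<longleftrightarrow>
     (\<forall>r\<in>{1..m-1}. \<forall>t\<in>{0..1::real}.
        (\<integral>x. max (win_prob r x - t) 0 \<partial>W)
          \<le> 1 - t - (real m - real r) / real m * (1 - t powr (real m / (real m - real r))))"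

section \<open>Discrete OCS\<close>

definition valid_input :: "nat \<Rightarrow> 'i set \<Rightarrow> (nat \<Rightarrow> 'i multiset) \<Rightarrow> bool" where
  "valid_input m L A \<longleftrightarrow> (\<forall>j. size (A j) = m \<and> set_mset (A j) \<subseteq> L)"

(* An online randomized selection algorithm is represented by the law, for each (fixed) input
   sequence, of the random sequence of winners.  Being online and irrevocable means that the law
   of the winners of the first n steps depends on the first n multisets only. *)
definition discrete_OCS ::
  "nat \<Rightarrow> 'i set \<Rightarrow> ((nat \<Rightarrow> 'i multiset) \<Rightarrow> (nat \<Rightarrow> 'i) measure) \<Rightarrow> bool" where
  "discrete_OCS m L ocs \<longleftrightarrow>
     (\<forall>A. valid_input m L A \<longrightarrow>
        prob_space (ocs A) \<and>
        sets (ocs A) = sets (Pi\<^sub>M (UNIV :: nat set) (\<lambda>_. count_space (UNIV :: 'i set))) \<and>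
        (AE \<omega> in ocs A. \<forall>j. \<omega> j \<in># A j)) \<and>
     (\<forall>A A' n. valid_input m L A \<and> valid_input m L A' \<and> (\<forall>j<n. A j = A' j) \<longrightarrow>
        distr (ocs A) (Pi\<^sub>M {..<n} (\<lambda>_. count_space UNIV)) (\<lambda>\<omega>. restrict \<omega> {..<n}) =
        distr (ocs A') (Pi\<^sub>M {..<n} (\<lambda>_. count_space UNIV)) (\<lambda>\<omega>. restrict \<omega> {..<n}))"

definition consecutive :: "nat set \<Rightarrow> bool" where
  "consecutive S \<longleftrightarrow> (\<exists>j1 j2. j1 < j2 \<and> S = {j1..j2})"

definition total_count :: "(nat \<Rightarrow> 'i multiset) \<Rightarrow> 'i \<Rightarrow> nat set \<Rightarrow> nat" where
  "total_count A i S = (\<Sum>j\<in>S. count (A j) i)"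

definition F_discrete_OCS ::
  "(nat \<Rightarrow> real) \<Rightarrow> nat \<Rightarrow> 'i set \<Rightarrow> ((nat \<Rightarrow> 'i multiset) \<Rightarrow> (nat \<Rightarrow> 'i) measure) \<Rightarrow> bool" where
  "F_discrete_OCS F m L ocs \<longleftrightarrow>
     discrete_OCS m L ocs \<and>
     (\<forall>A i k S.
        valid_input m L A \<and> i \<in> L \<and>
        (\<forall>l<k. consecutive (S l)) \<and> disjoint_family_on S {..<(k::nat)} \<longrightarrow>
        measure (ocs A) {\<omega> \<in> space (ocs A). \<forall>j\<in>(\<Union>l<k. S l). \<omega> j \<noteq> i}
          \<le> (\<Prod>l<k. F (total_count A i (S l))))"

section \<open>The OCS of a win distribution and a tournament subroutine\<close>

(* T A w is the law of the winner, given the multiset A (whose multiplicities are count A) and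
   the desired win probabilities w of the elements of A.  Measurability in w makes running T on
   random win probabilities meaningful. *)
definition tournament_subroutine ::
  "nat \<Rightarrow> 'i set \<Rightarrow> ('i multiset \<Rightarrow> ('i \<Rightarrow> real) \<Rightarrow> 'i pmf) \<Rightarrow> bool" where
  "tournament_subroutine m L T \<longleftrightarrow>
     (\<forall>A. size A = m \<and> set_mset A \<subseteq> L \<longrightarrow>
        (\<forall>w \<in> (\<Pi>\<^sub>E i\<in>set_mset A. {0..1}). set_pmf (T A w) \<subseteq> set_mset A) \<and>
        (\<forall>i. (\<lambda>w. pmf (T A w) i) \<in> borel_measurable (Pi\<^sub>M (set_mset A) (\<lambda>_. unit_interval))))"

primrec start_index :: "(nat \<Rightarrow> 'i multiset) \<Rightarrow> nat \<Rightarrow> 'i \<Rightarrow> nat" where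
  "start_index A 0 i = 0"
| "start_index A (Suc j) i = start_index A j i + count (A j) i"

definition desired_win_prob ::
  "(nat \<Rightarrow> 'i multiset) \<Rightarrow> ('i \<Rightarrow> nat \<Rightarrow> real) \<Rightarrow> nat \<Rightarrow> 'i \<Rightarrow> real" where
  "desired_win_prob A x j =
     (\<lambda>i\<in>set_mset (A j). 1 - (\<Prod>l<count (A j) i. (1 - x i (start_index A j i + l))))"

(* The desired win probabilities do not depend on earlier winners, so with fresh randomness in
   every round the winners are independent across rounds, conditionally on the initial draws x. *)
definition OCS ::
  "'i set \<Rightarrow> (nat \<Rightarrow> real) measure \<Rightarrow> ('i multiset \<Rightarrow> ('i \<Rightarrow> real) \<Rightarrow> 'i pmf)
     \<Rightarrow> (nat \<Rightarrow> 'i multiset) \<Rightarrow> (nat \<Rightarrow> 'i) measure" where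
  "OCS L W T A =
     Giry_Monad.bind (Pi\<^sub>M L (\<lambda>_. W))
       (\<lambda>x. Pi\<^sub>M UNIV (\<lambda>j. measure_pmf (T (A j) (desired_win_prob A x j))))"

end

theory Submission
  imports Defs
begin

text \<open>
  If every element with multiplicity \<open>r\<close> gets an independent score distributed as the maximum of \<open>r\<close>
  uniform variables and the largest score wins, then an element with score \<open>v\<close> wins with probability
  \<open>v ^ (m - r)\<close>.  The smallness hypothesis says exactly that the win probability of multiplicity \<open>r\<close> is
  below the law of \<open>v ^ (m - r)\<close> in the increasing convex order.  Hence there is a coupling, given by a
  sequence of balayage steps, in which the score is stochastically increasing in the desired win
  probability \<open>w\<close> and in which the conditional mean of \<open>v ^ (m - r)\<close> given \<open>w\<close> is at least \<open>w\<close>.  So an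
  element wins with conditional probability at least \<open>w\<close>, while its losing indicators are nondecreasing
  in the variables of the other elements and use disjoint blocks of them.  Negative association, which
  passes to independent unions, bounds the probability of losing all rounds, given the element's own
  sequence, by the product of the factors \<open>1 - w\<close>.  A second use of negative association, together with
  shift invariance, splits the mean of this product into the factors \<open>F\<close>.
\<close>

section \<open>Chord replacement\<close>

text \<open>The right side of the smallness hypothesis is the integral of
  \<open>1 - y powr (r / (m - r))\<close> from \<open>t\<close> to \<open>1\<close>, that is, the
  mean of \<open>max (Y - t) 0\<close> for \<open>Y = v ^ (m - r)\<close> with \<open>v\<close> a
  maximum of \<open>r\<close> uniform variables. So the power of the score, and not the score, is
  the quantity to be coupled. Domination of these means yields a submartingale coupling by
  Strassen's theorem, but such a coupling may send a larger \<open>w\<close> to smaller scores, and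
  the losing indicators might then fail to be monotone. This obstacle is why the coupling is built
  by hand: replacing a stretch of a function by its chord is linear, so it can be applied to the
  conditional means for all \<open>w\<close> at once and preserves the order between them. One-sided
  bounds suffice afterwards: a lower bound on the mean given \<open>w\<close>, and an upper bound on
  the tail averaged over \<open>w\<close>, which multiplies over independent opponents. Given
  \<open>w\<close>, the score may have atoms; hence a tie-breaking rank and strict inequalities in
  the estimates. The own sequence of an element is kept fixed because it pushes the losing indicator
  in the direction opposite to the other sequences.\<close>

definition chord :: "real \<Rightarrow> real \<Rightarrow> (real \<Rightarrow> real) \<Rightarrow> real \<Rightarrow> real" where
  "chord a b f t = (if a < t \<and> t < b then f a + (t - a) * (f b - f a) / (b - a) else f t)"

text \<open>Linearity in \<open>f\<close>. It lets \<open>chord_antimono\<close> be applied to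
  differences such as \<open>k w' - k w\<close>, which is how bounds on increments survive the
  replacement.\<close>

lemma chord_diff: "chord a b (\<lambda>t. f t - g t) t = chord a b f t - chord a b g t"
  by (auto simp: chord_def diff_divide_distrib right_diff_distrib)

lemma chord_between:
  assumes "f b \<le> f a" "a < t" "t < b"
  shows "f b \<le> chord a b f t" "chord a b f t \<le> f a"
proof -
  define l where "l = (t - a) / (b - a)"
  have l: "0 \<le> l" "l \<le> 1" using assms by (auto simp: l_def)
  have eq: "chord a b f t = f a - l * (f a - f b)"
    using assms by (simp add: chord_def l_def field_simps)
  have "l * (f a - f b) \<le> 1 * (f a - f b)" by (rule mult_right_mono) (use l assms in auto)
  then show "f b \<le> chord a b f t" by (simp add: eq)
  show "chord a b f t \<le> f a" using l assms by (simp add: eq)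
qed

text \<open>A linear piece between two values of a nonincreasing function stays between these
  values, so it cannot break the order with points outside. If the interval is degenerate, the chord
  is the identity.\<close>

lemma chord_antimono:
  assumes anti: "\<And>s t. 0 \<le> s \<Longrightarrow> s \<le> t \<Longrightarrow> t \<le> 1 \<Longrightarrow> f t \<le> f s"
    and ab: "0 \<le> a" "a \<le> b" "b \<le> 1" and st: "0 \<le> s" "s \<le> t" "t \<le> 1"
  shows "chord a b f t \<le> chord a b f s"
proof (cases "a < b")
  case True
  have fab: "f b \<le> f a" using anti ab by simp
  show ?thesis
  proof (cases "a < s \<and> s < b"; cases "a < t \<and> t < b")
    assume s: "a < s \<and> s < b" and t: "a < t \<and> t < b"
    have "(t - s) * (f b - f a) \<le> 0" using st fab by (simp add: mult_nonneg_nonpos)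
    then have "(t - a) * (f b - f a) \<le> (s - a) * (f b - f a)" by (simp add: algebra_simps)
    with True s t show ?thesis by (simp add: chord_def divide_right_mono)
  next
    assume s: "a < s \<and> s < b" and t: "\<not> (a < t \<and> t < b)"
    then have "f t \<le> f b" using anti st ab by auto
    with chord_between(1)[where f=f, OF fab, of s] s t show ?thesis by (auto simp: chord_def)
  next
    assume s: "\<not> (a < s \<and> s < b)" and t: "a < t \<and> t < b"
    then have "f a \<le> f s" using anti st ab by auto
    with chord_between(2)[where f=f, OF fab, of t] s t show ?thesis by (auto simp: chord_def)
  next
    assume "\<not> (a < s \<and> s < b)" "\<not> (a < t \<and> t < b)"
    then show ?thesis using anti st by (auto simp: chord_def)
  qed
next
  case False
  then have "chord a b f = f" by (auto simp: chord_def)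
  then show ?thesis using anti st by simp
qed

text \<open>The three-point inequality cleared of denominators, so that coinciding points are
  covered.\<close>

lemma convex_on_slopes:
  fixes f :: "real \<Rightarrow> real"
  assumes "convex_on S f" "x \<in> S" "z \<in> S" "x \<le> y" "y \<le> z"
  shows "(z - x) * f y \<le> (z - y) * f x + (y - x) * f z"
proof (cases "x < z")
  case True
  define l where "l = (y - x) / (z - x)"
  have "f ((1 - l) * x + l * z) \<le> (1 - l) * f x + l * f z"
    using convex_onD[OF assms(1), of l x z] assms True by (simp add: l_def)
  moreover have "l * (z - x) = y - x" using True by (simp add: l_def)
  then have "(1 - l) * x + l * z = y" by (simp add: algebra_simps)
  moreover have "(1 - l) = (z - y) / (z - x)" using True by (simp add: l_def field_simps)
  ultimately have "f y \<le> ((z - y) * f x + (y - x) * f z) / (z - x)"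
    using True by (simp add: l_def add_divide_distrib)
  then show ?thesis using True by (simp add: pos_le_divide_eq mult.commute)
next
  case False
  then have "x = y" "z = y" using assms by auto
  then show ?thesis by simp
qed

text \<open>By convexity the secant lies above \<open>f\<close> between \<open>a\<close> and
  \<open>b\<close> and below it elsewhere on the unit interval. In this form both the convexity of
  the chord replacement and its comparison with \<open>f\<close> are immediate.\<close>

lemma chord_eq_max:
  assumes f: "convex_on {0..1} f" and ab: "0 \<le> a" "a < b" "b \<le> 1" and t: "t \<in> {0..1}"
  shows "chord a b f t = max (f t) (f a + (t - a) * (f b - f a) / (b - a))"
proof -
  let ?L = "f a + (t - a) * (f b - f a) / (b - a)"
  have L: "(b - a) * ?L = (b - t) * f a + (t - a) * f b" using ab by (simp add: field_simps)
  consider "t \<le> a" | "a < t" "t < b" | "b \<le> t" by linarith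
  then show ?thesis
  proof cases
    case 1
    then have "(b - t) * f a \<le> (b - a) * f t + (a - t) * f b"
      using convex_on_slopes[OF f, of t b a] ab t by auto
    then have "(b - a) * ?L \<le> (b - a) * f t" unfolding L by (simp add: algebra_simps)
    then have "?L \<le> f t" using ab by simp
    then show ?thesis using 1 by (simp add: chord_def)
  next
    case 2
    then have "(b - a) * f t \<le> (b - t) * f a + (t - a) * f b"
      using convex_on_slopes[OF f, of a b t] ab t by auto
    then have "f t \<le> ?L" using ab unfolding L[symmetric] by simp
    then show ?thesis using 2 by (simp add: chord_def)
  next
    case 3
    then have "(t - a) * f b \<le> (t - b) * f a + (b - a) * f t"
      using convex_on_slopes[OF f, of a t b] ab t by auto
    then have "(b - a) * ?L \<le> (b - a) * f t" unfolding L by (simp add: algebra_simps)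
    then have "?L \<le> f t" using ab by simp
    then show ?thesis using 3 by (simp add: chord_def)
  qed
qed

lemma convex_on_max_real:
  fixes f g :: "real \<Rightarrow> real"
  assumes f: "convex_on S f" and g: "convex_on S g"
  shows "convex_on S (\<lambda>x. max (f x) (g x))"
proof (rule convex_onI)
  fix l x y :: real assume l: "0 < l" "l < 1" and xy: "x \<in> S" "y \<in> S"
  have "f ((1 - l) *\<^sub>R x + l *\<^sub>R y) \<le> (1 - l) * f x + l * f y"
    "g ((1 - l) *\<^sub>R x + l *\<^sub>R y) \<le> (1 - l) * g x + l * g y"
    using convex_onD[OF f, of l x y] convex_onD[OF g, of l x y] l xy by auto
  moreover have "(1 - l) * f x \<le> (1 - l) * max (f x) (g x)" "l * f y \<le> l * max (f y) (g y)"
    "(1 - l) * g x \<le> (1 - l) * max (f x) (g x)" "l * g y \<le> l * max (f y) (g y)"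
    using l by (auto intro!: mult_left_mono)
  ultimately show "max (f ((1 - l) *\<^sub>R x + l *\<^sub>R y)) (g ((1 - l) *\<^sub>R x + l *\<^sub>R y))
      \<le> (1 - l) * max (f x) (g x) + l * max (f y) (g y)" by linarith
qed (use f in \<open>simp add: convex_on_def\<close>)

lemma convex_on_affine: "convex S \<Longrightarrow> convex_on S (\<lambda>t. p + (t - a) * q / r)" for p q r a :: real
  by (rule convex_onI) (auto simp: algebra_simps add_divide_distrib diff_divide_distrib)

lemma chord_convex:
  assumes f: "convex_on {0..1} f" and ab: "0 \<le> a" "a < b" "b \<le> 1"
  shows "convex_on {0..1} (chord a b f)"
proof -
  let ?g = "\<lambda>t. max (f t) (f a + (t - a) * (f b - f a) / (b - a))"
  have g: "convex_on {0..1} ?g"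
    by (rule convex_on_max_real[OF f convex_on_affine]) simp
  show ?thesis
  proof (rule convex_onI)
    fix l x y :: real assume l: "0 < l" "l < 1" and xy: "x \<in> {0..1}" "y \<in> {0..1}"
    have "(1 - l) *\<^sub>R x + l *\<^sub>R y \<in> {0..1}"
      using convexD_alt[of "{0..1::real}" x y l] l xy by simp
    then show "chord a b f ((1 - l) *\<^sub>R x + l *\<^sub>R y) \<le> (1 - l) * chord a b f x + l * chord a b f y"
      unfolding chord_eq_max[OF f ab] using convex_onD[OF g, of l x y] l xy
      by (simp only: chord_eq_max[OF f ab])
  qed simp
qed

lemma chord_ge:
  assumes "convex_on {0..1} f" "0 \<le> a" "a < b" "b \<le> 1" "t \<in> {0..1}"
  shows "f t \<le> chord a b f t"
  by (simp add: chord_eq_max[OF assms])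


section \<open>A stochastically monotone coupling\<close>

text \<open>\<open>c t\<close> stands for the mean of \<open>max (Y - t) 0\<close> for the target
  variable \<open>Y\<close>, and \<open>d\<close> for its derivative. Stating only the tangent
  inequality, a slope bound and the value at \<open>1\<close> keeps \<open>Y\<close> and
  differentiability out of the construction.\<close>

locale convex_dominated = prob_space M for M :: "'a measure" +
  fixes X :: "'a \<Rightarrow> real" and c d :: "real \<Rightarrow> real"
  assumes X [measurable]: "X \<in> borel_measurable M"
    and X_range: "\<And>x. x \<in> space M \<Longrightarrow> X x \<in> {0..1}"
    and tangent: "\<And>s t. s \<in> {0..1} \<Longrightarrow> t \<in> {0..1} \<Longrightarrow> c s + d s * (t - s) \<le> c t"
    and c_ge: "\<And>t. t \<in> {0..1} \<Longrightarrow> c 0 - t \<le> c t"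
    and c_1: "c 1 = 0"
    and dominated: "\<And>t. t \<in> {0..1} \<Longrightarrow> (\<integral>x. max (X x - t) 0 \<partial>M) \<le> c t"
begin

lemma integrable_bounded:
  assumes "f \<in> borel_measurable M" "\<And>x. x \<in> space M \<Longrightarrow> f x \<in> {0..1::real}"
  shows "integrable M f"
  by (rule integrable_const_bound[of _ 1]) (use assms in auto)

text \<open>Balayage preserves the mean, so the mean of \<open>X\<close> must be raised beforehand
  to the target mean \<open>c 0\<close>. The mean of \<open>max (X x) \<alpha>\<close> is
  1-Lipschitz in \<open>\<alpha>\<close>, at most \<open>c 0\<close> at \<open>\<alpha> = 0\<close>,
  and \<open>1\<close> at \<open>\<alpha> = 1\<close>; \<open>c_ge\<close> and \<open>c_1\<close>
  give \<open>c 0 \<le> 1\<close>.\<close>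

lemma lifted_mean:
  obtains \<alpha> where "\<alpha> \<in> {0..1}" "(\<integral>x. max (X x) \<alpha> \<partial>M) = c 0"
proof -
  let ?g = "\<lambda>\<alpha>. \<integral>x. max (X x) \<alpha> \<partial>M"
  have int: "integrable M (\<lambda>x. max (X x) \<alpha>)" if "\<alpha> \<in> {0..1}" for \<alpha>
    by (rule integrable_bounded) (use that X_range in \<open>auto simp: max_def\<close>)
  have "?g \<alpha> - ?g \<beta> \<le> \<bar>\<alpha> - \<beta>\<bar>" if "\<alpha> \<in> {0..1}" "\<beta> \<in> {0..1}" for \<alpha> \<beta>
  proof -
    have "?g \<alpha> - ?g \<beta> = (\<integral>x. max (X x) \<alpha> - max (X x) \<beta> \<partial>M)"
      using int that by simp
    also have "\<dots> \<le> (\<integral>x. \<bar>\<alpha> - \<beta>\<bar> \<partial>M)"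
      by (rule integral_mono) (use int that in auto)
    finally show ?thesis by (simp add: prob_space)
  qed
  then have "1-lipschitz_on {0..1} ?g"
    by (intro lipschitz_onI) (auto simp: dist_real_def abs_le_iff, (fastforce simp: abs_minus_commute)+)
  then have cont: "continuous_on {0..1} ?g" by (rule lipschitz_on_continuous_on)
  have "?g 0 = (\<integral>x. max (X x - 0) 0 \<partial>M)" by simp
  then have "?g 0 \<le> c 0" using dominated[of 0] by simp
  moreover have "?g 1 = (\<integral>x. 1 \<partial>M)"
    by (rule Bochner_Integration.integral_cong) (use X_range in \<open>auto simp: max_def\<close>)
  then have "?g 1 \<ge> c 0" using c_ge[of 1] c_1 by (simp add: prob_space)
  ultimately show ?thesis using IVT'[of ?g 0 "c 0" 1] cont that by auto
qed

text \<open>Think of \<open>k w t\<close> as the conditional mean of \<open>max (Z - t) 0\<close> given \<open>w\<close>: convexity in \<open>t\<close> and slopes in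
  \<open>[-1, 0]\<close> make it come from a law of \<open>Z\<close> on the unit interval, and the second clause is stochastic
  monotonicity in \<open>w\<close>.\<close>

definition interpolant :: "(real \<Rightarrow> real \<Rightarrow> real) \<Rightarrow> bool" where
  "interpolant k \<longleftrightarrow>
     (\<forall>w. convex_on {0..1} (k w)) \<and>
     (\<forall>w w' s t. w \<le> w' \<longrightarrow> 0 \<le> s \<longrightarrow> s \<le> t \<longrightarrow> t \<le> 1 \<longrightarrow> k w s - k w t \<le> k w' s - k w' t) \<and>
     (\<forall>w s t. 0 \<le> s \<longrightarrow> s \<le> t \<longrightarrow> t \<le> 1 \<longrightarrow> k w t \<le> k w s \<and> k w s - k w t \<le> t - s) \<and>
     (\<forall>w\<in>{0..1}. w \<le> k w 0) \<and> (\<forall>w. k w 1 = 0) \<and>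
     (\<integral>x. k (X x) 0 \<partial>M) = c 0 \<and> (\<forall>t\<in>{0..1}. (\<integral>x. k (X x) t \<partial>M) \<le> c t)"

context
  fixes k
  assumes k: "interpolant k"
begin

lemma interpolant_convex: "convex_on {0..1} (k w)"
  using k by (simp add: interpolant_def)

lemma interpolant_diff_mono:
  "w \<le> w' \<Longrightarrow> 0 \<le> s \<Longrightarrow> s \<le> t \<Longrightarrow> t \<le> 1 \<Longrightarrow> k w s - k w t \<le> k w' s - k w' t"
  using k by (simp add: interpolant_def)

lemma interpolant_antimono: "0 \<le> s \<Longrightarrow> s \<le> t \<Longrightarrow> t \<le> 1 \<Longrightarrow> k w t \<le> k w s"
  using k by (simp add: interpolant_def)

lemma interpolant_diff_le: "0 \<le> s \<Longrightarrow> s \<le> t \<Longrightarrow> t \<le> 1 \<Longrightarrow> k w s - k w t \<le> t - s"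
  using k by (simp add: interpolant_def)

lemma interpolant_0: "w \<in> {0..1} \<Longrightarrow> w \<le> k w 0"
  using k by (simp add: interpolant_def)

lemma interpolant_1: "k w 1 = 0"
  using k by (simp add: interpolant_def)

lemma interpolant_mono: "w \<le> w' \<Longrightarrow> t \<in> {0..1} \<Longrightarrow> k w t \<le> k w' t"
  using interpolant_diff_mono[of w w' t 1] by (simp add: interpolant_1)

lemma interpolant_range: "t \<in> {0..1} \<Longrightarrow> k w t \<in> {0..1}"
  using interpolant_antimono[of t 1 w] interpolant_diff_le[of t 1 w] by (simp add: interpolant_1)

lemma interpolant_borel: "t \<in> {0..1} \<Longrightarrow> (\<lambda>w. k w t) \<in> borel_measurable borel"
  by (rule borel_measurable_mono) (simp add: mono_def interpolant_mono)

lemma interpolant_measurable [measurable]: "t \<in> {0..1} \<Longrightarrow> (\<lambda>x. k (X x) t) \<in> borel_measurable M"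
  using measurable_compose[OF X interpolant_borel] .

lemma interpolant_integrable: "t \<in> {0..1} \<Longrightarrow> integrable M (\<lambda>x. k (X x) t)"
  using interpolant_range by (intro integrable_bounded) auto

lemma interpolant_mean_0: "(\<integral>x. k (X x) 0 \<partial>M) = c 0"
  using k by (simp add: interpolant_def)

lemma interpolant_mean_le: "t \<in> {0..1} \<Longrightarrow> (\<integral>x. k (X x) t \<partial>M) \<le> c t"
  using k by (simp add: interpolant_def)

lemma interpolant_continuous: "continuous_on {0..1} (\<lambda>t. \<integral>x. k (X x) t \<partial>M)"
proof -
  let ?g = "\<lambda>t. \<integral>x. k (X x) t \<partial>M"
  have "?g s - ?g t \<le> \<bar>s - t\<bar>" if "s \<in> {0..1}" "t \<in> {0..1}" for s t
  proof -
    have "?g s - ?g t = (\<integral>x. k (X x) s - k (X x) t \<partial>M)"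
      using interpolant_integrable that by simp
    also have "\<dots> \<le> (\<integral>x. \<bar>s - t\<bar> \<partial>M)"
    proof (rule integral_mono)
      fix x show "k (X x) s - k (X x) t \<le> \<bar>s - t\<bar>"
        using interpolant_diff_le[of s t "X x"] interpolant_antimono[of t s "X x"] that
        by (cases "s \<le> t") auto
    qed (use interpolant_integrable that in auto)
    finally show ?thesis by (simp add: prob_space)
  qed
  then have "1-lipschitz_on {0..1} ?g"
    by (intro lipschitz_onI) (auto simp: dist_real_def abs_le_iff, (fastforce simp: abs_minus_commute)+)
  then show ?thesis by (rule lipschitz_on_continuous_on)
qed

text \<open>Where the tangent of \<open>c\<close> at \<open>s\<close> exceeds the mean of \<open>k\<close>, the mean of \<open>k\<close> is replaced by the tangent.
  This is a chord replacement, a linear operation that can be applied to every \<open>k w\<close> separately.\<close>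

lemma interpolant_touch:
  assumes s: "s \<in> {0..1}"
  shows "\<exists>k'. interpolant k' \<and> (\<forall>w. \<forall>t\<in>{0..1}. k w t \<le> k' w t) \<and> (\<integral>x. k' (X x) s \<partial>M) = c s"
proof (cases "(\<integral>x. k (X x) s \<partial>M) = c s")
  case True
  then show ?thesis using k by blast
next
  case False
  let ?g = "\<lambda>t. \<integral>x. k (X x) t \<partial>M"
  let ?l = "\<lambda>t. c s + d s * (t - s)"
  have gs: "?g s < ?l s" using False interpolant_mean_le[OF s] by simp
  have cont: "continuous_on {0..1} (\<lambda>t. ?g t - ?l t)"
    by (intro continuous_intros interpolant_continuous)
  \<comment> \<open>The mean of \<open>k\<close> lies on or above the tangent at both ends: at
    \<open>0\<close> it equals \<open>c 0\<close>, and at \<open>1\<close> both \<open>k\<close> and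
    \<open>c\<close> vanish. As it is below the tangent at \<open>s\<close>, there are crossing
    points on either side.\<close>
  have g0: "0 \<le> ?g 0 - ?l 0" using tangent[OF s, of 0] interpolant_mean_0 by simp
  have g1: "0 \<le> ?g 1 - ?l 1" using tangent[OF s, of 1] by (simp add: interpolant_1 c_1)
  obtain a where a: "0 \<le> a" "a \<le> s" "?g a - ?l a = 0"
    using IVT2'[of "\<lambda>t. ?g t - ?l t" s 0 0] g0 gs s continuous_on_subset[OF cont, of "{0..s}"] by auto
  obtain b where b: "s \<le> b" "b \<le> 1" "?g b - ?l b = 0"
    using IVT'[of "\<lambda>t. ?g t - ?l t" s 0 1] g1 gs s continuous_on_subset[OF cont, of "{s..1}"] by auto
  have ab: "0 \<le> a" "a < b" "b \<le> 1" and asb: "a < s" "s < b"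
    using a b gs by (force simp: less_le)+
  have ga: "?g a = ?l a" and gb: "?g b = ?l b" using a b by auto
  \<comment> \<open>The end points are crossing points of the mean and are the same for every
    \<open>w\<close>. Hence the mean of the chords is the chord of the mean, which is a piece of the
    tangent.\<close>
  define k' where "k' w = chord a b (k w)" for w
  have in_ab: "(\<integral>x. k' (X x) t \<partial>M) = ?l t" if "a < t" "t < b" for t
  proof -
    have "(\<integral>x. k' (X x) t \<partial>M)
        = (\<integral>x. k (X x) a + (t - a) * (k (X x) b - k (X x) a) / (b - a) \<partial>M)"
      using that by (simp add: k'_def chord_def)
    also have "\<dots> = ?g a + (t - a) * (?g b - ?g a) / (b - a)"
      using ab by (simp add: interpolant_integrable)
    also have "?g b - ?g a = d s * (b - a)"
      unfolding ga gb by (simp add: algebra_simps)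
    also have "(t - a) * (d s * (b - a)) / (b - a) = (t - a) * d s"
      using ab by simp
    also have "?g a + (t - a) * d s = ?l t"
      by (simp add: ga algebra_simps)
    finally show ?thesis .
  qed
  have le: "k w t \<le> k' w t" if "t \<in> {0..1}" for w t
    unfolding k'_def using chord_ge[OF interpolant_convex ab that] .
  have "interpolant k'"
    unfolding interpolant_def
  proof (intro conjI allI ballI impI)
    fix w show "convex_on {0..1} (k' w)"
      unfolding k'_def by (rule chord_convex[OF interpolant_convex ab])
  next
    fix w w' s t :: real assume w: "w \<le> w'" and st: "0 \<le> s" "s \<le> t" "t \<le> 1"
    \<comment> \<open>Stochastic monotonicity says that \<open>k w' - k w\<close> is nonincreasing
      in \<open>t\<close>, a property that the chord keeps.\<close>
    have "chord a b (\<lambda>t. k w' t - k w t) t \<le> chord a b (\<lambda>t. k w' t - k w t) s"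
      using interpolant_diff_mono[OF w] ab st by (intro chord_antimono) (auto simp: algebra_simps)
    then show "k' w s - k' w t \<le> k' w' s - k' w' t"
      by (simp add: chord_diff k'_def)
  next
    fix w s t :: real assume st: "0 \<le> s" "s \<le> t" "t \<le> 1"
    show "k' w t \<le> k' w s"
      unfolding k'_def using interpolant_antimono ab st by (intro chord_antimono) auto
    \<comment> \<open>Slopes at least \<open>-1\<close> mean that \<open>- t - k w t\<close> is
      nonincreasing; the chord leaves the linear part unchanged.\<close>
    have "chord a b (\<lambda>t. - t - k w t) t \<le> chord a b (\<lambda>t. - t - k w t) s"
      using interpolant_diff_le ab st by (intro chord_antimono) (auto simp: algebra_simps)
    moreover have "chord a b uminus t = - t" for t
      using ab by (simp add: chord_def field_simps)
    ultimately show "k' w s - k' w t \<le> t - s"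
      by (simp add: chord_diff k'_def)
  next
    fix w :: real assume "w \<in> {0..1}"
    then show "w \<le> k' w 0" using interpolant_0[of w] le[of 0 w] by simp
  next
    fix w show "k' w 1 = 0" using ab by (simp add: k'_def chord_def interpolant_1)
  next
    show "(\<integral>x. k' (X x) 0 \<partial>M) = c 0" using ab by (simp add: k'_def chord_def interpolant_mean_0)
  next
    fix t :: real assume t: "t \<in> {0..1}"
    show "(\<integral>x. k' (X x) t \<partial>M) \<le> c t"
    proof (cases "a < t \<and> t < b")
      case True
      then show ?thesis using in_ab tangent[OF s t] by simp
    next
      case False
      then have "k' w t = k w t" for w by (auto simp: k'_def chord_def)
      then show ?thesis using interpolant_mean_le[OF t] by simp
    qed
  qed
  then show ?thesis using le in_ab[OF asb] by auto
qed

end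

text \<open>The starting point takes \<open>Z\<close> to be the constant \<open>v w\<close>, the
  desired probability raised to \<open>\<alpha>\<close>. For \<open>t\<close> above
  \<open>\<alpha>\<close> the mean bound is the domination hypothesis; below \<open>\<alpha>\<close>
  the mean of \<open>k\<close> is the line \<open>c 0 - t\<close>. The cap at \<open>1\<close> is
  there because most clauses of \<open>interpolant\<close> range over all real
  \<open>w\<close>.\<close>

lemma interpolant_exists: "\<exists>k. interpolant k"
proof -
  obtain \<alpha> where \<alpha>: "\<alpha> \<in> {0..1}" "(\<integral>x. max (X x) \<alpha> \<partial>M) = c 0" by (rule lifted_mean)
  define v where "v w = min 1 (max w \<alpha>)" for w :: real
  define k where "k w t = max (v w - t) 0" for w t :: real
  have v: "v w \<in> {0..1}" for w using \<alpha> by (auto simp: v_def)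
  have vX: "v (X x) = max (X x) \<alpha>" if "x \<in> space M" for x
    using X_range[OF that] \<alpha> by (auto simp: v_def)
  have [measurable]: "(\<lambda>x. v (X x)) \<in> borel_measurable M" unfolding v_def by measurable
  have mean_0: "(\<integral>x. v (X x) \<partial>M) = c 0"
    using \<alpha> vX by (simp cong: Bochner_Integration.integral_cong)
  have "interpolant k"
    unfolding interpolant_def
  proof (intro conjI allI ballI impI)
    fix w show "convex_on {0..1} (k w)"
      unfolding k_def using convex_on_affine[of "{0..1}" "v w" 0 "-1" 1]
      by (intro convex_on_max_real) (auto simp: convex_on_def)
  next
    fix w w' s t :: real assume w: "w \<le> w'" and st: "0 \<le> s" "s \<le> t" "t \<le> 1"
    have "v w \<le> v w'" using w by (auto simp: v_def)
    then show "k w s - k w t \<le> k w' s - k w' t" using st by (auto simp: k_def max_def)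
  next
    fix w s t :: real assume st: "0 \<le> s" "s \<le> t" "t \<le> 1"
    show "k w t \<le> k w s" "k w s - k w t \<le> t - s" using st by (auto simp: k_def max_def)
  next
    fix w :: real assume "w \<in> {0..1}" then show "w \<le> k w 0" by (auto simp: k_def v_def)
  next
    fix w show "k w 1 = 0" using v[of w] by (simp add: k_def)
  next
    have "k w 0 = v w" for w using v[of w] by (simp add: k_def)
    then show "(\<integral>x. k (X x) 0 \<partial>M) = c 0" by (simp add: mean_0)
  next
    fix t :: real assume t: "t \<in> {0..1}"
    show "(\<integral>x. k (X x) t \<partial>M) \<le> c t"
    proof (cases "\<alpha> \<le> t")
      case True
      then have "k (X x) t = max (X x - t) 0" if "x \<in> space M" for x
        using that vX by (auto simp: k_def max_def)
      then have "(\<integral>x. k (X x) t \<partial>M) = (\<integral>x. max (X x - t) 0 \<partial>M)"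
        by (simp cong: Bochner_Integration.integral_cong)
      then show ?thesis using dominated[OF t] by simp
    next
      case False
      then have "k (X x) t = v (X x) - t" if "x \<in> space M" for x
        using \<alpha> by (auto simp: k_def v_def)
      then have "(\<integral>x. k (X x) t \<partial>M) = (\<integral>x. v (X x) - t \<partial>M)"
        by (simp cong: Bochner_Integration.integral_cong)
      also have "\<dots> = c 0 - t"
        using integrable_bounded[of "\<lambda>x. v (X x)"] v by (simp add: mean_0 prob_space)
      finally show ?thesis using c_ge[OF t] by simp
    qed
  qed
  then show ?thesis by blast
qed


text \<open>Contact with \<open>c\<close> is never lost, since the functions only grow while their
  means stay below \<open>c\<close>. Touching the rational points one after another and passing to
  the pointwise limit gives contact at all of them, and every clause of \<open>interpolant\<close>
  is closed under this limit.\<close>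

lemma interpolant_limit:
  "\<exists>k. interpolant k \<and> (\<forall>t\<in>\<rat> \<inter> {0..1}. (\<integral>x. k (X x) t \<partial>M) = c t)"
proof -
  define q where "q = from_nat_into (\<rat> \<inter> {0..1::real})"
  have ne: "\<rat> \<inter> {0..1::real} \<noteq> {}" by (auto intro!: exI[of _ 0])
  have cnt: "countable (\<rat> \<inter> {0..1::real})" using countable_rat by (rule countable_subset[rotated]) auto
  have q: "range q = \<rat> \<inter> {0..1}" unfolding q_def by (rule range_from_nat_into[OF ne cnt])
  have q01: "q n \<in> {0..1}" for n using q by blast
  have "\<exists>f. \<forall>n. interpolant (f n) \<and> ((\<forall>w. \<forall>t\<in>{0..1}. f n w t \<le> f (Suc n) w t) \<and>
      (\<integral>x. f (Suc n) (X x) (q n) \<partial>M) = c (q n))"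
    by (rule dependent_nat_choice) (use interpolant_exists interpolant_touch q01 in auto)
  then obtain f where f: "\<And>n. interpolant (f n)"
    and f_Suc: "\<And>n w t. t \<in> {0..1} \<Longrightarrow> f n w t \<le> f (Suc n) w t"
    and f_q: "\<And>n. (\<integral>x. f (Suc n) (X x) (q n) \<partial>M) = c (q n)"
    by blast
  have f_mono: "f m w t \<le> f n w t" if "t \<in> {0..1}" "m \<le> n" for m n w t
    using lift_Suc_mono_le[of "\<lambda>n. f n w t" m n] f_Suc that by blast
  define K where "K w t = lim (\<lambda>n. f n w t)" for w t
  have lim: "(\<lambda>n. f n w t) \<longlonglongrightarrow> K w t" if t: "t \<in> {0..1}" for w t
  proof -
    have "incseq (\<lambda>n. f n w t)" using f_mono[OF t] by (auto simp: incseq_def)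
    moreover have "\<forall>n. f n w t \<le> 1" using interpolant_range[OF f t] by auto
    ultimately obtain L where "(\<lambda>n. f n w t) \<longlonglongrightarrow> L" by (rule incseq_convergent)
    then show ?thesis unfolding K_def by (simp add: limI)
  qed
  have mean: "(\<lambda>n. \<integral>x. f n (X x) t \<partial>M) \<longlonglongrightarrow> (\<integral>x. K (X x) t \<partial>M)" if t: "t \<in> {0..1}" for t
  proof (rule integral_dominated_convergence[where w = "\<lambda>_. 1"])
    show meas: "(\<lambda>x. f n (X x) t) \<in> borel_measurable M" for n
      by (rule interpolant_measurable[OF f t])
    show "(\<lambda>x. K (X x) t) \<in> borel_measurable M"
      by (rule borel_measurable_LIMSEQ_real[OF lim[OF t] meas])
    show "AE x in M. norm (f n (X x) t) \<le> 1" for n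
      using interpolant_range[OF f t] by auto
  qed (use lim[OF t] in auto)
  have eq: "(\<integral>x. K (X x) (q m) \<partial>M) = c (q m)" for m
  proof (rule LIMSEQ_unique[OF mean[OF q01]])
    have "(\<integral>x. f n (X x) (q m) \<partial>M) = c (q m)" if n: "n \<ge> Suc m" for n
    proof (rule antisym[OF interpolant_mean_le[OF f q01]])
      have "(\<integral>x. f (Suc m) (X x) (q m) \<partial>M) \<le> (\<integral>x. f n (X x) (q m) \<partial>M)"
        using f_mono[OF q01 n] interpolant_integrable[OF f q01] by (intro integral_mono) auto
      then show "c (q m) \<le> (\<integral>x. f n (X x) (q m) \<partial>M)" by (simp add: f_q)
    qed
    then show "(\<lambda>n. \<integral>x. f n (X x) (q m) \<partial>M) \<longlonglongrightarrow> c (q m)"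
      by (intro tendsto_eventually eventually_sequentiallyI[of "Suc m"]) auto
  qed
  have "interpolant K"
    unfolding interpolant_def
  proof (intro conjI allI ballI impI)
    fix w show "convex_on {0..1} (K w)"
    proof (rule convex_onI)
      fix l x y :: real assume l: "0 < l" "l < 1" and xy: "x \<in> {0..1}" "y \<in> {0..1}"
      have z: "(1 - l) *\<^sub>R x + l *\<^sub>R y \<in> {0..1}"
        using convexD_alt[of "{0..1::real}" x y l] l xy by simp
      have "(\<lambda>n. (1 - l) * f n w x + l * f n w y) \<longlonglongrightarrow> (1 - l) * K w x + l * K w y"
        by (intro tendsto_intros lim xy)
      then show "K w ((1 - l) *\<^sub>R x + l *\<^sub>R y) \<le> (1 - l) * K w x + l * K w y"
        by (rule LIMSEQ_le[OF lim[OF z]])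
          (use convex_onD[OF interpolant_convex[OF f]] l xy in auto)
    qed simp
  next
    fix w w' s t :: real assume w: "w \<le> w'" and st: "0 \<le> s" "s \<le> t" "t \<le> 1"
    show "K w s - K w t \<le> K w' s - K w' t"
      by (rule LIMSEQ_le[OF tendsto_diff[OF lim lim] tendsto_diff[OF lim lim]])
        (use interpolant_diff_mono[OF f w st] st in auto)
  next
    fix w s t :: real assume st: "0 \<le> s" "s \<le> t" "t \<le> 1"
    show "K w t \<le> K w s"
      by (rule LIMSEQ_le[OF lim lim]) (use interpolant_antimono[OF f st] st in auto)
    show "K w s - K w t \<le> t - s"
      by (rule LIMSEQ_le_const2[OF tendsto_diff[OF lim lim]]) (use interpolant_diff_le[OF f st] st in auto)
  next
    fix w :: real assume "w \<in> {0..1}"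
    then show "w \<le> K w 0"
      by (intro LIMSEQ_le_const[OF lim]) (use interpolant_0[OF f] in auto)
  next
    fix w show "K w 1 = 0"
      by (rule LIMSEQ_unique[OF lim]) (auto simp: interpolant_1[OF f])
  next
    show "(\<integral>x. K (X x) 0 \<partial>M) = c 0"
      by (rule LIMSEQ_unique[OF mean]) (auto simp: interpolant_mean_0[OF f])
  next
    fix t :: real assume t: "t \<in> {0..1}"
    show "(\<integral>x. K (X x) t \<partial>M) \<le> c t"
      by (rule LIMSEQ_le_const2[OF mean[OF t]]) (use interpolant_mean_le[OF f t] in auto)
  qed
  moreover have "(\<integral>x. K (X x) t \<partial>M) = c t" if "t \<in> \<rat> \<inter> {0..1}" for t
    using that eq unfolding q[symmetric] by auto
  ultimately show ?thesis by blast
qed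

end

section \<open>The uniform variable and the quantile transform\<close>

abbreviation unif :: "real measure" where
  "unif \<equiv> uniform_measure lborel {0..1}"

lemma prob_space_unif: "prob_space unif"
  by (rule prob_space_uniform_measure) auto

lemma measure_unif_lessThan: "0 \<le> p \<Longrightarrow> p \<le> 1 \<Longrightarrow> measure unif {..<p} = p"
proof -
  assume p: "0 \<le> p" "p \<le> 1"
  have "{0..1} \<inter> {..<p} = {0..<p}" using p by auto
  then show ?thesis using p divide_ennreal[of p 1] by (simp add: measure_def)
qed

context convex_dominated
begin

text \<open>Generalised inverse of the tail \<open>t \<mapsto> - (d/dt) k w t\<close>; rational difference quotients instead of the
  derivative make joint measurability immediate.\<close>

definition quantile :: "(real \<Rightarrow> real \<Rightarrow> real) \<Rightarrow> real \<Rightarrow> real \<Rightarrow> real" where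
  "quantile k w u = Sup (insert 0 {t \<in> \<rat>. \<exists>t'\<in>\<rat>. 0 \<le> t \<and> t < t' \<and> t' \<le> 1 \<and> u * (t' - t) < k w t - k w t'})"

context
  fixes k
  assumes k: "interpolant k"
begin

lemma quantile_bdd:
  "bdd_above (insert 0 {t \<in> \<rat>. \<exists>t'\<in>\<rat>. 0 \<le> t \<and> t < t' \<and> t' \<le> 1 \<and> u * (t' - t) < k w t - k w t'})"
  by (rule bdd_aboveI[of _ 1]) auto

lemma less_quantile_iff:
  "s < quantile k w u \<longleftrightarrow>
     s < 0 \<or> (\<exists>t\<in>\<rat>. \<exists>t'\<in>\<rat>. s < t \<and> 0 \<le> t \<and> t < t' \<and> t' \<le> 1 \<and> u * (t' - t) < k w t - k w t')"
  unfolding quantile_def by (subst less_cSup_iff[OF _ quantile_bdd]) auto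

lemma quantile_ge:
  assumes "t \<in> \<rat>" "t' \<in> \<rat>" "0 \<le> t" "t < t'" "t' \<le> 1" "u * (t' - t) < k w t - k w t'"
  shows "t \<le> quantile k w u"
  unfolding quantile_def by (rule cSup_upper[OF _ quantile_bdd]) (use assms in auto)

lemma quantile_range: "quantile k w u \<in> {0..1}"
proof -
  have "quantile k w u \<le> 1" unfolding quantile_def by (rule cSup_least) auto
  moreover have "0 \<le> quantile k w u"
    unfolding quantile_def by (rule cSup_upper[OF _ quantile_bdd]) simp
  ultimately show ?thesis by simp
qed

text \<open>One \<open>u\<close> serves all \<open>w\<close>: increments grow with \<open>w\<close>,
  so every rational witness for \<open>w\<close> is one for \<open>w'\<close>. This turns the
  stochastic order into a pointwise one.\<close>

lemma quantile_mono:
  assumes "w \<le> w'"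
  shows "quantile k w u \<le> quantile k w' u"
proof (rule ccontr)
  assume "\<not> ?thesis"
  then obtain t t' where "t \<in> \<rat>" "t' \<in> \<rat>" "quantile k w' u < t" "0 \<le> t" "t < t'" "t' \<le> 1"
    "u * (t' - t) < k w t - k w t'"
    using quantile_range[of w' u] unfolding not_le less_quantile_iff by auto
  moreover from this have "k w t - k w t' \<le> k w' t - k w' t'"
    using interpolant_diff_mono[OF k assms, of t t'] by simp
  ultimately show False using quantile_ge[of t t' u w'] by simp
qed

text \<open>A strict superlevel set is a countable union over pairs of rational points, and for each
  pair the condition is Borel because \<open>k w t\<close> is monotone in \<open>w\<close>.\<close>

lemma quantile_measurable: "(\<lambda>(w, u). quantile k w u) \<in> borel_measurable (borel \<Otimes>\<^sub>M borel)"
  unfolding borel_measurable_iff_greater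
proof
  fix s
  have [measurable]: "(\<lambda>x. k (fst x) t) \<in> borel_measurable (borel \<Otimes>\<^sub>M borel)" if "t \<in> {0..1}" for t
    using measurable_compose[OF measurable_fst interpolant_borel[OF k that]] .
  let ?R = "\<rat> \<inter> {0..1::real}"
  have cnt: "countable ?R" using countable_rat by (rule countable_subset[rotated]) auto
  have "{z \<in> space (borel \<Otimes>\<^sub>M borel). s < (case z of (w, u) \<Rightarrow> quantile k w u)} =
    {z \<in> space (borel \<Otimes>\<^sub>M borel). s < 0 \<or> (\<exists>t\<in>?R. \<exists>t'\<in>?R.
        s < t \<and> t < t' \<and> snd z * (t' - t) < k (fst z) t - k (fst z) t')}"
    by (auto simp: less_quantile_iff space_pair_measure)
  also have "\<dots> \<in> sets (borel \<Otimes>\<^sub>M borel)"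
    using cnt by measurable
  finally show "{z \<in> space (borel \<Otimes>\<^sub>M borel). s < (case z of (w, u) \<Rightarrow> quantile k w u)}
      \<in> sets (borel \<Otimes>\<^sub>M borel)" .
qed

lemma quantile_measurable_snd: "quantile k w \<in> borel_measurable borel"
  using measurable_compose[OF measurable_Pair1' quantile_measurable, of w] by simp

text \<open>A discrete layer-cake formula: on a grid of width \<open>1 / N\<close> the tails become
  difference quotients of \<open>k w\<close>, which telescope to \<open>k w 0\<close>. The error
  \<open>1 / N\<close> tends to zero.\<close>

lemma integral_quantile_ge:
  assumes w: "w \<in> {0..1}"
  shows "w \<le> (\<integral>u. quantile k w u \<partial>unif)"
proof -
  interpret U: prob_space unif by (rule prob_space_unif)
  have intq: "integrable unif (quantile k w)"
    by (rule U.integrable_const_bound[of _ 1]) (use quantile_range quantile_measurable_snd in auto)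
  have bound: "k w 0 \<le> (\<integral>u. quantile k w u \<partial>unif) + 1 / real N" if N: "N > 0" for N :: nat
  proof -
    \<comment> \<open>\<open>E j\<close> consists of the \<open>u\<close> below the difference
      quotient on the \<open>j\<close>-th cell. The quotient lies in the unit interval, so it is the
      measure of \<open>E j\<close>.\<close>
    define E where "E j = {..< real N * (k w (j / N) - k w (Suc j / N))}" for j :: nat
    have j01: "0 \<le> real j / N" "real j / N \<le> real (Suc j) / N" "real (Suc j) / N \<le> 1" if "j < N" for j
      using that N by (auto simp: field_simps)
    have p: "0 \<le> N * (k w (j / N) - k w (Suc j / N))" "N * (k w (j / N) - k w (Suc j / N)) \<le> 1"
      if j: "j < N" for j
    proof -
      have "k w (j / N) - k w (Suc j / N) \<le> Suc j / N - j / N" "k w (Suc j / N) \<le> k w (j / N)"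
        using interpolant_diff_le[OF k j01[OF j]] interpolant_antimono[OF k j01[OF j]] .
      moreover have "Suc j / N - j / N = 1 / real N" by (simp add: diff_divide_distrib[symmetric])
      ultimately show "0 \<le> N * (k w (j / N) - k w (Suc j / N))" "N * (k w (j / N) - k w (Suc j / N)) \<le> 1"
        using N by (auto simp: field_simps)
    qed
    \<comment> \<open>The cells that count \<open>u\<close> have indices from \<open>0\<close> to
      \<open>Max J\<close>, and the left end of the last one is a rational witness, hence at most
      the quantile. The summand \<open>1\<close> pays for the index \<open>0\<close>.\<close>
    have ptw: "(\<Sum>j<N. indicator (E j) u) \<le> real N * quantile k w u + 1" for u
    proof -
      define J where "J = {j. j < N \<and> u \<in> E j}"
      have "(\<Sum>j<N. indicator (E j) u) = real (card J)"
        by (simp add: indicator_def J_def sum.If_cases Int_def)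
      also have "\<dots> \<le> real N * quantile k w u + 1"
      proof (cases "J = {}")
        case True
        then show ?thesis using quantile_range[of w u] by simp
      next
        case False
        have fin: "finite J" by (simp add: J_def)
        then have mx: "Max J \<in> J" using False by (rule Max_in)
        have "J \<subseteq> {..Max J}" using fin by auto
        then have "card J \<le> Suc (Max J)" using card_mono[of "{..Max J}" J] by simp
        moreover have "Max J / N \<le> quantile k w u"
        proof (rule quantile_ge[of _ "Suc (Max J) / N"])
          show "u * (real (Suc (Max J)) / real N - real (Max J) / real N)
              < k w (real (Max J) / real N) - k w (real (Suc (Max J)) / real N)"
            using mx N by (simp add: J_def E_def diff_divide_distrib[symmetric] field_simps)
        qed (use mx N j01[of "Max J"] in \<open>auto simp: J_def divide_strict_right_mono\<close>)
        then have "Max J \<le> real N * quantile k w u" using N by (simp add: field_simps)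
        ultimately show ?thesis by linarith
      qed
      finally show ?thesis .
    qed
    have "N * k w 0 = (\<Sum>j<N. N * (k w (j / N) - k w (Suc j / N)))"
      using sum_lessThan_telescope'[of "\<lambda>j. k w (j / N)" N] N
      by (simp add: sum_distrib_left[symmetric] interpolant_1[OF k])
    also have "\<dots> = (\<Sum>j<N. measure unif (E j))"
      by (intro sum.cong refl) (simp only: E_def lessThan_iff measure_unif_lessThan p)
    also have "\<dots> = (\<integral>u. (\<Sum>j<N. indicator (E j) u) \<partial>unif)"
      by (subst Bochner_Integration.integral_sum) (auto simp: E_def integrable_real_indicator emeasure_eq_measure U.emeasure_eq_measure)
    also have "\<dots> \<le> (\<integral>u. real N * quantile k w u + 1 \<partial>unif)"
      by (rule integral_mono)
        (use ptw intq in \<open>auto simp: E_def integrable_real_indicator U.emeasure_eq_measure\<close>)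
    also have "\<dots> = N * (\<integral>u. quantile k w u \<partial>unif) + 1"
      using intq U.prob_space by simp
    finally show ?thesis using N by (simp add: field_simps)
  qed
  have "k w 0 \<le> (\<integral>u. quantile k w u \<partial>unif) + 0"
    by (rule LIMSEQ_le_const[OF tendsto_add[OF tendsto_const lim_1_over_n]])
      (use bound in \<open>auto intro!: exI[of _ 1]\<close>)
  then show ?thesis using interpolant_0[OF k w] by simp
qed

text \<open>For a rational \<open>r\<close> between \<open>s\<close> and \<open>t\<close>, convexity
  makes the quotient of \<open>k w\<close> from \<open>s\<close> to \<open>r\<close> dominate every
  quotient further right, so it bounds the tail at \<open>t\<close>. On average over
  \<open>X\<close>, contact at \<open>r\<close> and domination at \<open>s\<close> bound it by the
  quotient of \<open>c\<close>, hence by \<open>- d s\<close>.\<close>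

lemma quantile_tail:
  assumes eq: "\<And>t. t \<in> \<rat> \<inter> {0..1} \<Longrightarrow> (\<integral>x. k (X x) t \<partial>M) = c t"
    and st: "0 \<le> s" "s < t" "t \<le> 1"
  shows "(\<integral>x. measure unif {u. t \<le> quantile k (X x) u} \<partial>M) \<le> - d s"
proof -
  interpret U: prob_space unif by (rule prob_space_unif)
  obtain r where r: "r \<in> \<rat>" "s < r" "r < t" using Rats_dense_in_real[OF st(2)] by blast
  have s01: "s \<in> {0..1}" and r01: "r \<in> {0..1}" using st r by auto
  have le: "measure unif {u. t \<le> quantile k w u} \<le> (k w s - k w r) / (r - s)" for w
  proof -
    define p where "p = (k w s - k w r) / (r - s)"
    have p: "0 \<le> p" "p \<le> 1"
      using interpolant_antimono[OF k, of s r w] interpolant_diff_le[OF k, of s r w] st r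
      by (auto simp: p_def)
    have "{u. t \<le> quantile k w u} \<subseteq> {..<p}"
    proof
      fix u assume "u \<in> {u. t \<le> quantile k w u}"
      then have "r < quantile k w u" using r by simp
      then obtain a b where ab: "r < a" "a < b" "b \<le> 1" "u * (b - a) < k w a - k w b"
        using r01 unfolding less_quantile_iff by auto
      \<comment> \<open>The next two inequalities order the descents of \<open>k w\<close> on the
        successive intervals with ends \<open>s < r < a < b\<close>; the last of them exceeds
        \<open>u\<close>.\<close>
      have "(a - s) * k w r \<le> (a - r) * k w s + (r - s) * k w a"
        using convex_on_slopes[OF interpolant_convex[OF k], of s a r] st r ab by auto
      then have 1: "(r - s) * (k w r - k w a) \<le> (a - r) * (k w s - k w r)" by (simp add: algebra_simps)
      have "(b - r) * k w a \<le> (b - a) * k w r + (a - r) * k w b"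
        using convex_on_slopes[OF interpolant_convex[OF k], of r b a] st r ab by auto
      then have 2: "(a - r) * (k w a - k w b) \<le> (b - a) * (k w r - k w a)" by (simp add: algebra_simps)
      have "(r - s) * ((a - r) * (k w a - k w b)) \<le> (r - s) * ((b - a) * (k w r - k w a))"
        using 2 r by (intro mult_left_mono) auto
      also have "\<dots> = (b - a) * ((r - s) * (k w r - k w a))" by simp
      also have "\<dots> \<le> (b - a) * ((a - r) * (k w s - k w r))"
        using 1 ab by (intro mult_left_mono) auto
      finally have "(a - r) * ((r - s) * (k w a - k w b)) \<le> (a - r) * ((b - a) * (k w s - k w r))"
        by (simp add: mult.left_commute)
      then have "(r - s) * (k w a - k w b) \<le> (b - a) * (k w s - k w r)"
        using ab by simp
      moreover have "(r - s) * (u * (b - a)) < (r - s) * (k w a - k w b)"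
        using ab r by simp
      ultimately have "(b - a) * (u * (r - s)) < (b - a) * (k w s - k w r)"
        by (simp add: mult_ac)
      then have "u * (r - s) < k w s - k w r" using ab by simp
      then show "u \<in> {..<p}" using r by (simp add: p_def field_simps)
    qed
    then have "measure unif {u. t \<le> quantile k w u} \<le> measure unif {..<p}"
      by (intro U.finite_measure_mono) auto
    then show ?thesis using measure_unif_lessThan[OF p] by (simp add: p_def)
  qed
  have "(\<integral>x. measure unif {u. t \<le> quantile k (X x) u} \<partial>M) \<le> (\<integral>x. (k (X x) s - k (X x) r) / (r - s) \<partial>M)"
  proof (rule integral_mono)
    have "{z \<in> space (borel \<Otimes>\<^sub>M borel). t \<le> (case z of (w, u) \<Rightarrow> quantile k w u)} \<in> sets (borel \<Otimes>\<^sub>M unif)"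
      using quantile_measurable by (simp cong: sets_pair_measure_cong)
    then have "(\<lambda>w. measure unif (Pair w -` {z \<in> space (borel \<Otimes>\<^sub>M borel). t \<le> (case z of (w, u) \<Rightarrow> quantile k w u)}))
        \<in> borel_measurable borel"
      unfolding measure_def by (intro borel_measurable_enn2real U.measurable_emeasure_Pair)
    then have "(\<lambda>x. measure unif {u. t \<le> quantile k (X x) u}) \<in> borel_measurable M"
      by (intro measurable_compose[OF X]) (simp add: space_pair_measure vimage_def)
    then show "integrable M (\<lambda>x. measure unif {u. t \<le> quantile k (X x) u})"
      by (rule integrable_bounded) auto
    show "integrable M (\<lambda>x. (k (X x) s - k (X x) r) / (r - s))"
      using interpolant_integrable[OF k] s01 r01 by auto
  qed (rule le)
  also have "\<dots> = ((\<integral>x. k (X x) s \<partial>M) - c r) / (r - s)"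
    using interpolant_integrable[OF k] s01 r01 eq[of r] r by auto
  also have "\<dots> \<le> (c s - c r) / (r - s)"
    using interpolant_mean_le[OF k s01] r by (simp add: divide_right_mono)
  also have "\<dots> \<le> - d s"
    using tangent[OF s01 r01] r by (simp add: field_simps)
  finally show ?thesis .
qed

end

lemma monotone_coupling:
  obtains Q :: "real \<Rightarrow> real \<Rightarrow> real"
  where "(\<lambda>(w, u). Q w u) \<in> borel_measurable (borel \<Otimes>\<^sub>M borel)"
    and "\<And>w u. Q w u \<in> {0..1}" and "\<And>w w' u. w \<le> w' \<Longrightarrow> Q w u \<le> Q w' u"
    and "\<And>w. w \<in> {0..1} \<Longrightarrow> w \<le> (\<integral>u. Q w u \<partial>unif)"
    and "\<And>s t. 0 \<le> s \<Longrightarrow> s < t \<Longrightarrow> t \<le> 1 \<Longrightarrow> (\<integral>x. measure unif {u. t \<le> Q (X x) u} \<partial>M) \<le> - d s"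
proof -
  obtain k where k: "interpolant k" and eq: "\<forall>t\<in>\<rat> \<inter> {0..1}. (\<integral>x. k (X x) t \<partial>M) = c t"
    using interpolant_limit by blast
  show ?thesis
    using that[of "quantile k"] quantile_measurable[OF k] quantile_range[OF k] quantile_mono[OF k]
      integral_quantile_ge[OF k] quantile_tail[OF k] eq by blast
qed

end

section \<open>The tournament\<close>

text \<open>Convexity of the power function, obtained from Young's inequality with weights
  \<open>1 / q\<close> and \<open>1 - 1 / q\<close> applied to \<open>t powr q\<close> and
  \<open>s powr q\<close>.\<close>

lemma powr_above_tangent:
  fixes s t q :: real
  assumes "0 \<le> s" "0 \<le> t" "1 \<le> q"
  shows "s powr q + q * s powr (q - 1) * (t - s) \<le> t powr q"
proof (cases "s = 0 \<or> t = 0")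
  case True
  have "s powr (q - 1) * s = s powr q" using assms by (cases "s = 0") (auto simp: powr_diff)
  then have "q * s powr (q - 1) * s = q * s powr q" by simp
  moreover have "1 * s powr q \<le> q * s powr q" using assms by (intro mult_right_mono) auto
  ultimately show ?thesis using True by (auto simp: algebra_simps)
next
  case False
  have "(t powr q) powr (1 / q) * (s powr q) powr (1 - 1 / q) \<le> 1 / q * t powr q + (1 - 1 / q) * s powr q"
    using assms False by (intro Youngs_inequality_0) (auto simp: field_simps)
  moreover have "(t powr q) powr (1 / q) = t" "(s powr q) powr (1 - 1 / q) = s powr (q - 1)"
    using assms by (auto simp: powr_powr right_diff_distrib)
  ultimately have "t * s powr (q - 1) \<le> 1 / q * t powr q + (1 - 1 / q) * s powr q" by simp
  then have "q * (t * s powr (q - 1)) \<le> q * (1 / q * t powr q + (1 - 1 / q) * s powr q)"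
    using assms by (intro mult_left_mono) auto
  also have "\<dots> = t powr q + q * s powr q - s powr q"
    using assms by (simp add: algebra_simps)
  also have "s powr q = s * s powr (q - 1)"
    using assms False by (simp add: powr_diff)
  finally show ?thesis by (simp add: algebra_simps \<open>s powr q = s * s powr (q - 1)\<close>)
qed

section \<open>Win distributions and the score for a single multiplicity\<close>

lemma measurable_unif: "measurable N unif = borel_measurable N"
  by (rule measurable_cong_sets) simp_all

locale win_dist =
  fixes W :: "(nat \<Rightarrow> real) measure"
  assumes W: "win_distribution W"
begin

sublocale prob_space W
  using W by (simp add: win_distribution_def)

lemma sets_W [measurable_cong]: "sets W = sets (Pi\<^sub>M UNIV (\<lambda>_. unit_interval))"
  using W by (simp add: win_distribution_def)

lemma space_W: "space W = {x. \<forall>k. x k \<in> {0..1}}"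
  using sets_eq_imp_space_eq[OF sets_W] by (auto simp: space_PiM space_restrict_space)

lemma measurable_unit_interval_borel: "f \<in> measurable N unit_interval \<Longrightarrow> f \<in> borel_measurable N"
  by (simp add: measurable_restrict_space2_iff)

lemma measurable_W_component [measurable]: "(\<lambda>x. x k) \<in> borel_measurable W"
  by (rule measurable_unit_interval_borel) measurable

lemma measurable_into_W:
  assumes "\<And>k. (\<lambda>z. f z k) \<in> borel_measurable N" "\<And>z k. z \<in> space N \<Longrightarrow> f z k \<in> {0..1}"
  shows "f \<in> measurable N W"
proof -
  have "f \<in> measurable N (Pi\<^sub>M UNIV (\<lambda>_. unit_interval))"
    by (rule measurable_PiM_single') (use assms in \<open>auto intro!: measurable_restrict_space2 simp: space_restrict_space\<close>)
  then show ?thesis by (simp cong: measurable_cong_sets add: sets_W)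
qed

lemma win_prob_measurable [measurable]: "win_prob r \<in> borel_measurable W"
  unfolding win_prob_def[abs_def] by measurable

lemma win_prob_range: "x \<in> space W \<Longrightarrow> win_prob r x \<in> {0..1}"
  unfolding win_prob_def space_W by (auto intro!: prod_le_1 prod_nonneg)

lemma shift_measurable: "(\<lambda>x k. x (s + k)) \<in> measurable W W"
  by (rule measurable_into_W) (auto simp: space_W)

end

definition score_function :: "(real \<Rightarrow> real \<Rightarrow> real) \<Rightarrow> bool" where
  "score_function V \<longleftrightarrow>
    (\<lambda>(w, u). V w u) \<in> borel_measurable (borel \<Otimes>\<^sub>M borel) \<and> (\<forall>w u. V w u \<in> {0..1}) \<and>
    (\<forall>w w' u. w \<le> w' \<longrightarrow> V w u \<le> V w' u)"

locale small_win_dist = win_dist W for W +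
  fixes m :: nat
  assumes m: "m \<ge> 2" and small: "sufficiently_small m W"
begin

text \<open>The first clause: given \<open>w\<close>, the score beats \<open>m - r\<close>
  independent uniform variables with probability at least \<open>w\<close>. The second: averaged
  over the win probability, the score is stochastically at most a maximum of \<open>r\<close>
  uniform variables.\<close>

definition fair_score :: "nat \<Rightarrow> (real \<Rightarrow> real \<Rightarrow> real) \<Rightarrow> bool" where
  "fair_score r V \<longleftrightarrow>
    (\<forall>w\<in>{0..1}. w \<le> (\<integral>u. V w u ^ (m - r) \<partial>unif)) \<and>
    (\<forall>v\<in>{0..1}. v ^ r \<le> (\<integral>x. measure unif {u. V (win_prob r x) u < v} \<partial>W))"

lemma fair_score_exists:
  assumes r: "1 \<le> r" "r < m"
  shows "\<exists>V. score_function V \<and> fair_score r V"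
proof -
  \<comment> \<open>With this exponent, the power \<open>m - r\<close> of a maximum of
    \<open>r\<close> uniform variables has distribution function \<open>t powr (q - 1)\<close>. Then
    \<open>c t\<close> is the integral of its tail from \<open>t\<close> to \<open>1\<close>, and
    \<open>d\<close> is the derivative of \<open>c\<close>.\<close>
  define q where "q = real m / (real m - real r)"
  have q: "q > 1" "1 / q = (real m - real r) / real m" "q - 1 = real r / (real m - real r)"
    using r by (auto simp: q_def field_simps)
  define c where "c t = 1 - t - 1 / q * (1 - t powr q)" for t
  define d where "d t = t powr (q - 1) - 1" for t
  interpret convex_dominated W "win_prob r" c d
  proof
    fix s t :: real assume st: "s \<in> {0..1}" "t \<in> {0..1}"
    have "1 / q * (s powr q + q * s powr (q - 1) * (t - s)) \<le> 1 / q * t powr q"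
      using powr_above_tangent[of s t q] st q(1) by (intro mult_left_mono) auto
    then show "c s + d s * (t - s) \<le> c t" using q(1) by (simp add: c_def d_def algebra_simps)
  next
    fix t :: real assume "t \<in> {0..1}"
    then show "(\<integral>x. max (win_prob r x - t) 0 \<partial>W) \<le> c t"
      using small r m unfolding sufficiently_small_def c_def q(2) unfolding q_def by auto
  qed (use win_prob_range q(1) in \<open>auto simp: c_def right_diff_distrib\<close>)
  obtain Q where Q [measurable]: "(\<lambda>(w, u). Q w u) \<in> borel_measurable (borel \<Otimes>\<^sub>M borel)"
    and Q_range: "\<And>w u. Q w u \<in> {0..1}" and Q_mono: "\<And>w w' u. w \<le> w' \<Longrightarrow> Q w u \<le> Q w' u"
    and Q_mean: "\<And>w. w \<in> {0..1} \<Longrightarrow> w \<le> (\<integral>u. Q w u \<partial>unif)"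
    and Q_tail: "\<And>s t. 0 \<le> s \<Longrightarrow> s < t \<Longrightarrow> t \<le> 1 \<Longrightarrow> (\<integral>x. measure unif {u. t \<le> Q (win_prob r x) u} \<partial>W) \<le> - d s"
    by (rule monotone_coupling) (rule that; assumption)
  interpret U: prob_space unif by (rule prob_space_unif)
  define n where "n = m - r"
  have n: "n > 0" using r by (simp add: n_def)
  \<comment> \<open>The coupling concerns the power \<open>m - r\<close> of the score, so the score
    itself is a root.\<close>
  define V where "V w u = root n (Q w u)" for w u
  have Vn: "V w u ^ n = Q w u" for w u using Q_range[of w u] n by (simp add: V_def)
  have V_range: "V w u \<in> {0..1}" for w u using Q_range[of w u] n by (simp add: V_def)
  have V_meas: "(\<lambda>(w, u). V w u) \<in> borel_measurable (borel \<Otimes>\<^sub>M borel)"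
    unfolding V_def by measurable
  have tail: "v ^ r \<le> (\<integral>x. measure unif {u. V (win_prob r x) u < v} \<partial>W)" if v: "v \<in> {0..1}" for v
  proof (cases "v = 0")
    case True
    then show ?thesis using r by (simp add: power_0_left)
  next
    case False
    define t where "t = v ^ n"
    have t: "0 < t" "t \<le> 1" using v False by (auto simp: t_def power_le_one)
    define I where "I = (\<integral>x. measure unif {u. t \<le> Q (win_prob r x) u} \<partial>W)"
    have less_iff: "V w u < v \<longleftrightarrow> \<not> t \<le> Q w u" for w u
      using power_mono_iff[of v "V w u" n] V_range[of w u] v n by (auto simp: Vn t_def)
    have Qw [measurable]: "Q w \<in> borel_measurable borel" for w
      using measurable_compose[OF measurable_Pair1' Q, of w] by simp
    have compl: "measure unif {u. V w u < v} = 1 - measure unif {u. t \<le> Q w u}" for w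
    proof -
      have "{u. V w u < v} = space unif - {u. t \<le> Q w u}" by (auto simp: less_iff)
      moreover have "{u. t \<le> Q w u} \<in> U.events" by simp
      ultimately show ?thesis by (simp only: U.prob_compl)
    qed
    have sets: "{z \<in> space (borel \<Otimes>\<^sub>M borel). t \<le> (case z of (w, u) \<Rightarrow> Q w u)} \<in> sets (borel \<Otimes>\<^sub>M unif)"
      using Q by (simp cong: sets_pair_measure_cong)
    have "(\<lambda>w. measure unif (Pair w -` {z \<in> space (borel \<Otimes>\<^sub>M borel). t \<le> (case z of (w, u) \<Rightarrow> Q w u)}))
        \<in> borel_measurable borel"
      unfolding measure_def by (intro borel_measurable_enn2real U.measurable_emeasure_Pair sets)
    then have "(\<lambda>x. measure unif {u. t \<le> Q (win_prob r x) u}) \<in> borel_measurable W"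
      by (intro measurable_compose[OF win_prob_measurable]) (simp add: space_pair_measure vimage_def)
    then have "integrable W (\<lambda>x. measure unif {u. t \<le> Q (win_prob r x) u})"
      by (rule integrable_bounded) (simp_all only: atLeastAtMost_iff U.prob_le_1 measure_nonneg simp_thms)
    then have eq: "(\<integral>x. measure unif {u. V (win_prob r x) u < v} \<partial>W) = 1 - I"
      by (simp add: compl I_def prob_space)
    \<comment> \<open>The tail bound is available at every \<open>s < t\<close>; it reaches
      \<open>t\<close> by left continuity of the power function.\<close>
    have "t powr (q - 1) \<le> 1 - I"
    proof (rule tendsto_upperbound)
      show "((\<lambda>s. s powr (q - 1)) \<longlongrightarrow> t powr (q - 1)) (at_left t)"
        using t by (intro tendsto_intros) auto
      have "s powr (q - 1) \<le> 1 - I" if "0 < s" "s < t" for s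
        using Q_tail[of s t] that t by (simp add: d_def I_def)
      then show "\<forall>\<^sub>F s in at_left t. s powr (q - 1) \<le> 1 - I"
        using eventually_at_left_real[OF t(1)] by (auto elim!: eventually_mono)
    qed simp
    moreover have "t powr (q - 1) = v ^ r"
    proof -
      have "t = v powr real n" using v False by (simp add: t_def powr_realpow)
      then have "t powr (q - 1) = v powr (real n * (q - 1))" by (simp add: powr_powr)
      also have "real n * (q - 1) = real r" using r by (simp add: q(3) n_def of_nat_diff)
      finally show ?thesis using v False by (simp add: powr_realpow)
    qed
    ultimately show ?thesis unfolding eq by simp
  qed
  have V_mono: "V w u \<le> V w' u" if "w \<le> w'" for w w' u
    using Q_mono[OF that] n by (simp add: V_def)
  have V_mean: "w \<le> (\<integral>u. V w u ^ n \<partial>unif)" if "w \<in> {0..1}" for w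
    using Q_mean[OF that] by (simp only: Vn)
  show ?thesis
    unfolding n_def[symmetric] score_function_def fair_score_def
    by (intro exI[of _ V] conjI allI ballI impI V_meas V_range V_mono V_mean tail)
qed

end

text \<open>Scores may have atoms, so ties occur. A rank that ignores the win probabilities resolves
  them and keeps the contest monotone.\<close>

definition tie_rank :: "'i multiset \<Rightarrow> 'i \<Rightarrow> nat" where
  "tie_rank A = (SOME e. inj_on e (set_mset A))"

lemma inj_on_tie_rank: "inj_on (tie_rank A) (set_mset A)"
proof -
  have "\<exists>e :: 'a \<Rightarrow> nat. inj_on e (set_mset A)"
    using finite_imp_inj_to_nat_seg[OF finite_set_mset[of A]] by blast
  then show ?thesis unfolding tie_rank_def by (rule someI_ex[of "\<lambda>e. inj_on e (set_mset A)"])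
qed

text \<open>The element is found by maximizing \<open>e\<close> among the maximizers of
  \<open>f\<close>.\<close>

lemma unique_lexicographic_max:
  fixes f :: "'a \<Rightarrow> real" and e :: "'a \<Rightarrow> nat"
  assumes "finite B" "B \<noteq> {}" "inj_on e B"
  shows "\<exists>!i. i \<in> B \<and> (\<forall>j\<in>B - {i}. f j < f i \<or> f j = f i \<and> e j < e i)"
proof (rule ex_ex1I)
  define C where "C = {i \<in> B. f i = Max (f ` B)}"
  have "Max (f ` B) \<in> f ` B" using assms by (intro Max_in) auto
  then obtain b where "b \<in> B" "f b = Max (f ` B)" by (metis imageE)
  then have C: "finite C" "C \<noteq> {}" using assms by (auto simp: C_def)
  then have "Max (e ` C) \<in> e ` C" by (intro Max_in) auto
  then obtain i where i: "i \<in> C" "e i = Max (e ` C)" by auto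
  have "f j < f i \<or> f j = f i \<and> e j < e i" if j: "j \<in> B - {i}" for j
  proof (cases "j \<in> C")
    case True
    then have "e j \<le> e i" using C i by simp
    moreover have "e j \<noteq> e i" using j i assms by (auto simp: C_def inj_on_def)
    ultimately show ?thesis using True i by (auto simp: C_def)
  next
    case False
    have "f j \<le> Max (f ` B)" using j assms by auto
    then show ?thesis using False i j by (auto simp: C_def)
  qed
  moreover have "i \<in> B" using i by (simp add: C_def)
  ultimately show "\<exists>i. i \<in> B \<and> (\<forall>j\<in>B - {i}. f j < f i \<or> f j = f i \<and> e j < e i)"
    by blast
next
  fix i k
  assume i: "i \<in> B \<and> (\<forall>j\<in>B - {i}. f j < f i \<or> f j = f i \<and> e j < e i)"
    and k: "k \<in> B \<and> (\<forall>j\<in>B - {k}. f j < f k \<or> f j = f k \<and> e j < e k)"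
  show "i = k"
  proof (rule ccontr)
    assume "i \<noteq> k"
    then have "f k < f i \<or> f k = f i \<and> e k < e i" "f i < f k \<or> f i = f k \<and> e i < e k"
      using i k by auto
    then show False by auto
  qed
qed

section \<open>The contest in which the largest score wins\<close>

locale contest =
  fixes V :: "nat \<Rightarrow> real \<Rightarrow> real \<Rightarrow> real"
  assumes V [measurable]: "\<And>r. (\<lambda>(w, u). V r w u) \<in> borel_measurable (borel \<Otimes>\<^sub>M borel)"
    and V_mono: "\<And>r w w' u. w \<le> w' \<Longrightarrow> V r w u \<le> V r w' u"
begin

lemma V_measurable [measurable (raw)]:
  "f \<in> borel_measurable N \<Longrightarrow> g \<in> borel_measurable N \<Longrightarrow> (\<lambda>x. V r (f x) (g x)) \<in> borel_measurable N"
  using measurable_compose[OF measurable_Pair V, of f N g] by simp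

abbreviation noise :: "'i multiset \<Rightarrow> ('i \<Rightarrow> real) measure" where
  "noise A \<equiv> Pi\<^sub>M (set_mset A) (\<lambda>_. unif)"

definition tops :: "'i multiset \<Rightarrow> ('i \<Rightarrow> real) \<Rightarrow> ('i \<Rightarrow> real) \<Rightarrow> 'i \<Rightarrow> bool" where
  "tops A w U i \<longleftrightarrow> i \<in># A \<and> (\<forall>j\<in>set_mset A - {i}.
     V (count A j) (w j) (U j) < V (count A i) (w i) (U i) \<or>
     V (count A j) (w j) (U j) = V (count A i) (w i) (U i) \<and> tie_rank A j < tie_rank A i)"

definition contest :: "'i multiset \<Rightarrow> ('i \<Rightarrow> real) \<Rightarrow> 'i pmf" where
  "contest A w = embed_pmf (\<lambda>i. measure (noise A) {U \<in> space (noise A). tops A w U i})"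

lemma noise_prob_space: "prob_space (noise A)"
  by (rule prob_space_PiM) (rule prob_space_unif)

text \<open>Joint measurability in win probabilities and noise: integrating the noise out then
  leaves a measurable function of the win probabilities.\<close>

lemma tops_pair_sets:
  "{z \<in> space (Pi\<^sub>M (set_mset A) (\<lambda>_. borel) \<Otimes>\<^sub>M noise A). tops A (fst z) (snd z) i}
    \<in> sets (Pi\<^sub>M (set_mset A) (\<lambda>_. borel) \<Otimes>\<^sub>M noise A)"
proof (cases "i \<in># A")
  case True
  note [measurable] = finite_set_mset[of A]
  have [measurable]: "(\<lambda>z. V (count A j) (fst z j) (snd z j))
      \<in> borel_measurable (Pi\<^sub>M (set_mset A) (\<lambda>_. borel) \<Otimes>\<^sub>M noise A)" if "j \<in># A" for j
  proof -
    have "(\<lambda>U. U j) \<in> measurable (noise A) unif" using that by measurable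
    then have [measurable]: "(\<lambda>U. U j) \<in> borel_measurable (noise A)" by (simp add: measurable_unif)
    show ?thesis using that by measurable
  qed
  show ?thesis unfolding tops_def using True by measurable
qed (simp add: tops_def)

lemma tops_restrict: "tops A (restrict w (set_mset A)) U i = tops A w U i"
  by (cases "i \<in># A") (auto simp: tops_def)

lemma tops_sets: "{U \<in> space (noise A). tops A w U i} \<in> sets (noise A)"
proof -
  have "restrict w (set_mset A) \<in> space (Pi\<^sub>M (set_mset A) (\<lambda>_. borel))"
    by (simp add: space_PiM)
  from sets_Pair1[OF tops_pair_sets, of "restrict w (set_mset A)" A i] this
  show ?thesis by (simp add: space_pair_measure vimage_def Int_def tops_restrict)
qed

text \<open>For every noise exactly one element tops, so the weights add up to one; this is the
  condition under which \<open>embed_pmf\<close> returns them.\<close>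

lemma pmf_contest:
  assumes "A \<noteq> {#}"
  shows "pmf (contest A w) i = measure (noise A) {U \<in> space (noise A). tops A w U i}"
proof -
  interpret P: prob_space "noise A" by (rule noise_prob_space)
  let ?p = "\<lambda>i. measure (noise A) {U \<in> space (noise A). tops A w U i}"
  have ex1: "\<exists>!i. tops A w U i" for U
    unfolding tops_def using assms by (intro unique_lexicographic_max inj_on_tie_rank) auto
  then have uniq: "i = j" if "tops A w U i" "tops A w U j" for U i j using that by blast
  have ex: "\<exists>i\<in>#A. tops A w U i" for U using ex1[of U] unfolding tops_def by blast
  have disj: "disjoint_family_on (\<lambda>i. {U \<in> space (noise A). tops A w U i}) (set_mset A)"
    unfolding disjoint_family_on_def using uniq by blast
  have "(\<integral>\<^sup>+ i. ennreal (?p i) \<partial>count_space UNIV) = (\<Sum>i\<in>set_mset A. ennreal (?p i))"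
    by (rule nn_integral_count_space') (auto simp: tops_def)
  also have "\<dots> = ennreal (\<Sum>i\<in>set_mset A. ?p i)" by (simp add: sum_ennreal)
  also have "(\<Sum>i\<in>set_mset A. ?p i) = measure (noise A) (\<Union>i\<in>set_mset A. {U \<in> space (noise A). tops A w U i})"
    using tops_sets by (intro P.finite_measure_finite_Union[symmetric] disj) auto
  also have "(\<Union>i\<in>set_mset A. {U \<in> space (noise A). tops A w U i}) = space (noise A)"
    using ex by blast
  finally have "(\<integral>\<^sup>+ i. ennreal (?p i) \<partial>count_space UNIV) = 1" by (simp add: P.prob_space)
  then show ?thesis unfolding contest_def by (intro pmf_embed_pmf) auto
qed

lemma set_pmf_contest: "A \<noteq> {#} \<Longrightarrow> set_pmf (contest A w) \<subseteq> set_mset A"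
proof
  fix i assume A: "A \<noteq> {#}" and "i \<in> set_pmf (contest A w)"
  then have "measure (noise A) {U \<in> space (noise A). tops A w U i} \<noteq> 0"
    by (simp add: set_pmf_iff pmf_contest)
  then have "{U \<in> space (noise A). tops A w U i} \<noteq> {}" by (metis measure_empty)
  then show "i \<in># A" by (auto simp: tops_def)
qed

lemma contest_measurable:
  assumes "A \<noteq> {#}" and w: "\<And>c. c \<in># A \<Longrightarrow> (\<lambda>x. w x c) \<in> borel_measurable N"
  shows "(\<lambda>x. pmf (contest A (w x)) i) \<in> borel_measurable N"
proof -
  interpret P: prob_space "noise A" by (rule noise_prob_space)
  have "(\<lambda>x. restrict (w x) (set_mset A)) \<in> measurable N (Pi\<^sub>M (set_mset A) (\<lambda>_. borel))"
    using w by (intro measurable_restrict) auto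
  from measurable_compose[OF this P.measurable_emeasure_Pair[OF tops_pair_sets]]
  have "(\<lambda>x. emeasure (noise A) (Pair (restrict (w x) (set_mset A)) -`
    {z \<in> space (Pi\<^sub>M (set_mset A) (\<lambda>_. borel) \<Otimes>\<^sub>M noise A). tops A (fst z) (snd z) i})) \<in> borel_measurable N" .
  moreover have "Pair (restrict (w x) (set_mset A)) -`
    {z \<in> space (Pi\<^sub>M (set_mset A) (\<lambda>_. borel) \<Otimes>\<^sub>M noise A). tops A (fst z) (snd z) i}
    = {U \<in> space (noise A). tops A (w x) U i}" for x
    by (auto simp: space_pair_measure space_PiM tops_restrict)
  ultimately have "(\<lambda>x. emeasure (noise A) {U \<in> space (noise A). tops A (w x) U i}) \<in> borel_measurable N"
    by simp
  then show ?thesis unfolding pmf_contest[OF assms(1)] measure_def by measurable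
qed

text \<open>At fixed noise, larger win probabilities of the others raise only their scores, so no
  noise becomes favourable to \<open>i\<close>.\<close>

lemma contest_antimono:
  assumes A: "A \<noteq> {#}" and "w i = w' i" "\<And>c. c \<in># A \<Longrightarrow> c \<noteq> i \<Longrightarrow> w c \<le> w' c"
  shows "pmf (contest A w') i \<le> pmf (contest A w) i"
proof -
  interpret P: prob_space "noise A" by (rule noise_prob_space)
  have "tops A w U i" if "tops A w' U i" for U
    unfolding tops_def
  proof (intro conjI ballI)
    show "i \<in># A" using that by (simp add: tops_def)
    fix j assume j: "j \<in> set_mset A - {i}"
    have "V (count A j) (w j) (U j) \<le> V (count A j) (w' j) (U j)"
      using assms j by (intro V_mono) auto
    moreover have "V (count A j) (w' j) (U j) < V (count A i) (w i) (U i) \<or>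
        V (count A j) (w' j) (U j) = V (count A i) (w i) (U i) \<and> tie_rank A j < tie_rank A i"
      using that j assms(2) by (simp add: tops_def)
    ultimately show "V (count A j) (w j) (U j) < V (count A i) (w i) (U i) \<or>
        V (count A j) (w j) (U j) = V (count A i) (w i) (U i) \<and> tie_rank A j < tie_rank A i"
      by (auto simp: less_le)
  qed
  then show ?thesis unfolding pmf_contest[OF A] by (intro P.finite_measure_mono tops_sets) auto
qed

text \<open>Only strict victories are counted, so a tie is treated as a loss. For fixed own noise
  \<open>u\<close> the victories over different opponents depend on different noise coordinates, and
  their probabilities multiply.\<close>

lemma contest_ge:
  assumes i: "i \<in># A"
  shows "(\<integral>\<^sup>+ u. (\<Prod>c\<in>set_mset A - {i}. emeasure unif {u'. V (count A c) (w c) u' < V (count A i) (w i) u}) \<partial>unif)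
    \<le> ennreal (pmf (contest A w) i)"
proof -
  let ?B = "set_mset A - {i}"
  have A: "A \<noteq> {#}" using i by auto
  have ins: "insert i ?B = set_mset A" using i by auto
  interpret P: prob_space "noise A" by (rule noise_prob_space)
  interpret U: prob_space unif by (rule prob_space_unif)
  interpret prod: product_sigma_finite "\<lambda>_. unif" by unfold_locales
  define S where "S = {U \<in> space (noise A). \<forall>c\<in>?B. V (count A c) (w c) (U c) < V (count A i) (w i) (U i)}"
  have [measurable]: "(\<lambda>U. V (count A c) (w c) (U c)) \<in> borel_measurable (noise A)" if "c \<in># A" for c
  proof -
    have "(\<lambda>U. U c) \<in> measurable (noise A) unif" using that by measurable
    then have [measurable]: "(\<lambda>U. U c) \<in> borel_measurable (noise A)" by (simp add: measurable_unif)
    show ?thesis by measurable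
  qed
  note [measurable] = finite_set_mset[of A]
  have S: "S \<in> sets (noise A)" unfolding S_def using i by measurable
  have "ennreal (pmf (contest A w) i) = emeasure (noise A) {U \<in> space (noise A). tops A w U i}"
    by (simp add: pmf_contest[OF A] P.emeasure_eq_measure)
  also have "\<dots> \<ge> emeasure (noise A) S"
    by (rule emeasure_mono[OF _ tops_sets]) (use i in \<open>auto simp: S_def tops_def\<close>)
  also have "emeasure (noise A) S = (\<integral>\<^sup>+ U. indicator S U \<partial>Pi\<^sub>M (insert i ?B) (\<lambda>_. unif))"
    unfolding ins using S by (rule nn_integral_indicator[symmetric])
  also have "\<dots> = (\<integral>\<^sup>+ u. \<integral>\<^sup>+ U. indicator S (U(i := u)) \<partial>Pi\<^sub>M ?B (\<lambda>_. unif) \<partial>unif)"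
    by (rule prod.product_nn_integral_insert_rev) (unfold ins, use S in simp_all)
  also have "\<dots> = (\<integral>\<^sup>+ u. (\<Prod>c\<in>?B. emeasure unif {u'. V (count A c) (w c) u' < V (count A i) (w i) u}) \<partial>unif)"
  proof (rule nn_integral_cong)
    fix u
    let ?E = "\<lambda>c. {u'. V (count A c) (w c) u' < V (count A i) (w i) u}"
    have E: "?E c \<in> sets unif" for c by simp
    have "(\<integral>\<^sup>+ U. indicator S (U(i := u)) \<partial>Pi\<^sub>M ?B (\<lambda>_. unif))
        = (\<integral>\<^sup>+ U. indicator (Pi\<^sub>E ?B ?E) U \<partial>Pi\<^sub>M ?B (\<lambda>_. unif))"
    proof (rule nn_integral_cong)
      fix U assume U: "U \<in> space (Pi\<^sub>M ?B (\<lambda>_. unif))"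
      then have "U(i := u) \<in> space (noise A)" using i by (auto simp: space_PiM PiE_def extensional_def)
      then have "U(i := u) \<in> S \<longleftrightarrow> (\<forall>c\<in>?B. U c \<in> ?E c)" by (simp add: S_def)
      also have "\<dots> \<longleftrightarrow> U \<in> Pi\<^sub>E ?B ?E" using U by (simp add: space_PiM PiE_iff)
      finally show "(indicator S (U(i := u)) :: ennreal) = indicator (Pi\<^sub>E ?B ?E) U"
        by (simp only: indicator_def)
    qed
    also have "\<dots> = emeasure (Pi\<^sub>M ?B (\<lambda>_. unif)) (Pi\<^sub>E ?B ?E)"
      by (intro nn_integral_indicator sets_PiM_I_finite) (use E in auto)
    also have "\<dots> = (\<Prod>c\<in>?B. emeasure unif (?E c))"
      by (rule prod.emeasure_PiM) (use E in auto)
    finally show "(\<integral>\<^sup>+ U. indicator S (U(i := u)) \<partial>Pi\<^sub>M ?B (\<lambda>_. unif)) = (\<Prod>c\<in>?B. emeasure unif (?E c))" .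
  qed
  finally show ?thesis .
qed

end

section \<open>Win probability against random opponents\<close>

locale invariant_win_dist = win_dist W for W +
  assumes shift: "shift_invariant W"
begin

lemma nn_integral_shift:
  assumes [measurable]: "f \<in> borel_measurable W"
  shows "(\<integral>\<^sup>+x. f (\<lambda>k. x (s + k)) \<partial>W) = (\<integral>\<^sup>+x. f x \<partial>W)"
  using nn_integral_distr[OF shift_measurable[of s], of f] shift
  by (simp add: shift_invariant_def)

lemma integral_shift:
  fixes f :: "(nat \<Rightarrow> real) \<Rightarrow> real"
  assumes [measurable]: "f \<in> borel_measurable W"
  shows "(\<integral>x. f (\<lambda>k. x (s + k)) \<partial>W) = (\<integral>x. f x \<partial>W)"
  using integral_distr[OF shift_measurable[of s] assms] shift
  by (simp add: shift_invariant_def)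

end

locale fair_contest = contest V + invariant_win_dist W
  for V :: "nat \<Rightarrow> real \<Rightarrow> real \<Rightarrow> real" and W :: "(nat \<Rightarrow> real) measure" +
  fixes m :: nat
  assumes V_range: "\<And>r w u. V r w u \<in> {0..1}"
    and V_mean: "\<And>r w. 1 \<le> r \<Longrightarrow> r < m \<Longrightarrow> w \<in> {0..1} \<Longrightarrow> w \<le> (\<integral>u. V r w u ^ (m - r) \<partial>unif)"
    and V_tail: "\<And>r v. 1 \<le> r \<Longrightarrow> r < m \<Longrightarrow> v \<in> {0..1} \<Longrightarrow>
      v ^ r \<le> (\<integral>x. measure unif {u. V r (win_prob r x) u < v} \<partial>W)"
begin

lemma emeasure_below_measurable:
  "(\<lambda>z. emeasure unif {u. V r (fst z) u < snd z}) \<in> borel_measurable (borel \<Otimes>\<^sub>M borel)"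
proof -
  interpret U: prob_space unif by (rule prob_space_unif)
  let ?S = "{z \<in> space ((borel \<Otimes>\<^sub>M borel) \<Otimes>\<^sub>M borel). V r (fst (fst z)) (snd z) < snd (fst z)}"
  have "?S \<in> sets ((borel \<Otimes>\<^sub>M borel) \<Otimes>\<^sub>M borel)" by measurable
  then have "?S \<in> sets ((borel \<Otimes>\<^sub>M borel) \<Otimes>\<^sub>M unif)" by (simp cong: sets_pair_measure_cong)
  from U.measurable_emeasure_Pair[OF this] show ?thesis
    by (simp add: space_pair_measure vimage_def)
qed

lemma emeasure_below_measurable' [measurable (raw)]:
  "f \<in> borel_measurable N \<Longrightarrow> g \<in> borel_measurable N \<Longrightarrow>
    (\<lambda>x. emeasure unif {u. V r (f x) u < g x}) \<in> borel_measurable N"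
  using measurable_compose[OF measurable_Pair emeasure_below_measurable, of f N g] by simp

text \<open>The block of an opponent's sequence that a round reads may begin at any index
  \<open>s\<close>, whereas the score was constructed for the first block. Shift invariance closes
  this gap.\<close>

lemma emeasure_tail:
  assumes "1 \<le> r" "r < m" "v \<in> {0..1}"
  shows "ennreal (v ^ r) \<le> (\<integral>\<^sup>+x. emeasure unif {u. V r (win_prob r (\<lambda>k. x (s + k))) u < v} \<partial>W)"
proof -
  interpret U: prob_space unif by (rule prob_space_unif)
  have meas: "(\<lambda>x. emeasure unif {u. V r (win_prob r x) u < v}) \<in> borel_measurable W" by measurable
  have int: "integrable W (\<lambda>x. measure unif {u. V r (win_prob r x) u < v})"
  proof (rule integrable_const_bound[of _ 1])
    show "AE x in W. norm (measure unif {u. V r (win_prob r x) u < v}) \<le> 1"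
      by (intro AE_I2) (simp only: real_norm_def abs_of_nonneg[OF measure_nonneg] U.prob_le_1)
    show "(\<lambda>x. measure unif {u. V r (win_prob r x) u < v}) \<in> borel_measurable W"
      unfolding measure_def by (intro borel_measurable_enn2real meas)
  qed
  have "ennreal (v ^ r) \<le> ennreal (\<integral>x. measure unif {u. V r (win_prob r x) u < v} \<partial>W)"
    using V_tail[OF assms] by (rule ennreal_leI)
  also have "\<dots> = (\<integral>\<^sup>+x. ennreal (measure unif {u. V r (win_prob r x) u < v}) \<partial>W)"
    by (rule nn_integral_eq_integral[symmetric, OF int]) (simp only: measure_nonneg AE_I2 simp_thms)
  also have "\<dots> = (\<integral>\<^sup>+x. emeasure unif {u. V r (win_prob r x) u < v} \<partial>W)"
    by (simp only: U.emeasure_eq_measure)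
  also have "\<dots> = (\<integral>\<^sup>+x. emeasure unif {u. V r (win_prob r (\<lambda>k. x (s + k))) u < v} \<partial>W)"
    by (rule nn_integral_shift[symmetric, OF meas])
  finally show ?thesis .
qed

text \<open>Opponents fall below the own score \<open>v\<close> independently, each with average
  probability at least \<open>v ^ count A c\<close>. Their multiplicities sum to
  \<open>m - r\<close>, so the product is at least \<open>v ^ (m - r)\<close>, whose mean over the
  own noise is at least \<open>y\<close>. The bound is an average over the opponents' sequences, not
  one for each \<open>x\<close>.\<close>

lemma contest_wins:
  assumes A: "size A = m" and i: "i \<in># A" and y: "y \<in> {0..1}"
    and wi: "\<And>x. x \<in> space (Pi\<^sub>M (set_mset A - {i}) (\<lambda>_. W)) \<Longrightarrow> w x i = y"
    and wc: "\<And>x c. x \<in> space (Pi\<^sub>M (set_mset A - {i}) (\<lambda>_. W)) \<Longrightarrow> c \<in> set_mset A - {i} \<Longrightarrow>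
      w x c = win_prob (count A c) (\<lambda>k. x c (s c + k))"
  shows "y \<le> (\<integral>x. pmf (contest A (w x)) i \<partial>Pi\<^sub>M (set_mset A - {i}) (\<lambda>_. W))"
proof -
  let ?B = "set_mset A - {i}"
  let ?N = "Pi\<^sub>M ?B (\<lambda>_. W)"
  define r where "r = count A i"
  have ne: "A \<noteq> {#}" using i by auto
  have r1: "1 \<le> r" using i by (simp add: r_def Suc_le_eq)
  have cnt: "m = r + (\<Sum>c\<in>?B. count A c)"
    using A i by (simp add: size_multiset_overloaded_eq r_def sum.remove[of "set_mset A" i])
  interpret N: prob_space ?N by (rule prob_space_PiM) (rule prob_space_axioms)
  interpret U: prob_space unif by (rule prob_space_unif)
  interpret prod: product_sigma_finite "\<lambda>_. W" by unfold_locales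
  interpret pair_sigma_finite ?N unif by unfold_locales
  have win_shift: "(\<lambda>x. win_prob q (\<lambda>k. x c (s + k))) \<in> borel_measurable ?N" if "c \<in> ?B" for q c s
    using measurable_compose[OF measurable_component_singleton[OF that]
        measurable_compose[OF shift_measurable[of s] win_prob_measurable[of q]]]
    by simp
  have w_meas: "(\<lambda>x. w x c) \<in> borel_measurable ?N" if c: "c \<in># A" for c
  proof (cases "c = i")
    case True
    then show ?thesis using wi by (simp cong: measurable_cong)
  next
    case False
    then have "c \<in> ?B" using c by simp
    then show ?thesis using wc win_shift[of c "count A c" "s c"] by (simp cong: measurable_cong)
  qed
  have meas: "(\<lambda>x. pmf (contest A (w x)) i) \<in> borel_measurable ?N"
    by (rule contest_measurable[OF ne w_meas])
  have int: "integrable ?N (\<lambda>x. pmf (contest A (w x)) i)"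
  proof (rule N.integrable_const_bound[of _ 1, OF _ meas])
    show "AE x in ?N. norm (pmf (contest A (w x)) i) \<le> 1"
      by (rule AE_I2) (simp add: pmf_le_1)
  qed
  have "ennreal y \<le> (\<integral>\<^sup>+x. ennreal (pmf (contest A (w x)) i) \<partial>?N)"
  proof (cases "r = m")
    \<comment> \<open>All copies belong to \<open>i\<close>, the only contestant; this multiplicity
      is outside the range of \<open>V_mean\<close> and \<open>V_tail\<close>.\<close>
    case True
    have "?B = {}"
    proof (rule ccontr)
      assume "?B \<noteq> {}"
      then obtain c where c: "c \<in> ?B" by blast
      then have "count A c \<le> (\<Sum>c\<in>?B. count A c)" by (intro member_le_sum) auto
      moreover have "count A c > 0" using c by simp
      ultimately show False using cnt True by linarith
    qed
    then have "set_pmf (contest A (w x)) \<subseteq> {i}" for x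
      using set_pmf_contest[OF ne, of "w x"] i by auto
    then have "pmf (contest A (w x)) i = 1" for x
      by (simp add: set_pmf_subset_singleton)
    then show ?thesis using y by (simp add: N.emeasure_space_1)
  next
    case False
    then have rm: "r < m" using cnt False by linarith
    have sets_unif: "sets unif = sets borel" by simp
    have Vy': "V r y \<in> borel_measurable unif"
      unfolding measurable_cong_sets[OF sets_unif refl]
      by (rule V_measurable[OF measurable_const measurable_ident, of y r, unfolded id_def]) simp
    have V_pow: "0 \<le> V r y u ^ n" "V r y u ^ n \<le> 1" for u n
      using V_range[of r y u] by (auto intro: power_le_one)
    have int_V: "integrable unif (\<lambda>u. V r y u ^ (m - r))"
    proof (rule U.integrable_const_bound[of _ 1])
      show "AE u in unif. norm (V r y u ^ (m - r)) \<le> 1"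
        by (rule AE_I2) (simp only: real_norm_def abs_of_nonneg V_pow)
    qed (rule borel_measurable_power[OF Vy'])
    have "ennreal y \<le> ennreal (\<integral>u. V r y u ^ (m - r) \<partial>unif)"
      using V_mean[OF r1 rm y] by (rule ennreal_leI)
    also have "\<dots> = (\<integral>\<^sup>+u. ennreal (V r y u ^ (m - r)) \<partial>unif)"
      by (rule nn_integral_eq_integral[symmetric, OF int_V AE_I2]) (rule V_pow(1))
    also have "\<dots> = (\<integral>\<^sup>+u. (\<Prod>c\<in>?B. ennreal (V r y u ^ count A c)) \<partial>unif)"
    proof (rule nn_integral_cong)
      fix u
      have "V r y u ^ (m - r) = (\<Prod>c\<in>?B. V r y u ^ count A c)"
        using cnt by (simp add: power_sum[symmetric])
      then show "ennreal (V r y u ^ (m - r)) = (\<Prod>c\<in>?B. ennreal (V r y u ^ count A c))"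
        using V_range[of r y u] by (simp add: prod_ennreal)
    qed
    also have "\<dots> \<le> (\<integral>\<^sup>+u. (\<Prod>c\<in>?B. \<integral>\<^sup>+x. emeasure unif
        {u'. V (count A c) (win_prob (count A c) (\<lambda>k. x (s c + k))) u' < V r y u} \<partial>W) \<partial>unif)"
    proof (intro nn_integral_mono prod_mono_ennreal)
      fix u c assume c: "c \<in> ?B"
      have "count A c \<le> (\<Sum>c\<in>?B. count A c)" using c by (intro member_le_sum) auto
      then have cm: "count A c < m" using cnt r1 by linarith
      have c1: "1 \<le> count A c" using c by (simp add: Suc_le_eq)
      show "ennreal (V r y u ^ count A c) \<le> (\<integral>\<^sup>+x. emeasure unif
          {u'. V (count A c) (win_prob (count A c) (\<lambda>k. x (s c + k))) u' < V r y u} \<partial>W)"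
        by (rule emeasure_tail[OF c1 cm V_range])
    qed
    also have "\<dots> = (\<integral>\<^sup>+u. \<integral>\<^sup>+x. (\<Prod>c\<in>?B. emeasure unif
        {u'. V (count A c) (win_prob (count A c) (\<lambda>k. x c (s c + k))) u' < V r y u}) \<partial>?N \<partial>unif)"
    proof (rule nn_integral_cong)
      fix u
      have meas_c: "(\<lambda>x. emeasure unif {u'. V (count A c) (win_prob (count A c) (\<lambda>k. x (s c + k))) u' < V r y u})
          \<in> borel_measurable W" for c
        by (rule emeasure_below_measurable'[OF measurable_compose[OF shift_measurable win_prob_measurable]]) simp
      show "(\<Prod>c\<in>?B. \<integral>\<^sup>+x. emeasure unif
          {u'. V (count A c) (win_prob (count A c) (\<lambda>k. x (s c + k))) u' < V r y u} \<partial>W) =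
        (\<integral>\<^sup>+x. (\<Prod>c\<in>?B. emeasure unif
          {u'. V (count A c) (win_prob (count A c) (\<lambda>k. x c (s c + k))) u' < V r y u}) \<partial>?N)"
        by (rule prod.product_nn_integral_prod[symmetric, OF finite_Diff[OF finite_set_mset] meas_c])
    qed
    \<comment> \<open>The own noise moves inside because \<open>contest_ge\<close> is an estimate
      for fixed \<open>x\<close>.\<close>
    also have "\<dots> = (\<integral>\<^sup>+x. \<integral>\<^sup>+u. (\<Prod>c\<in>?B. emeasure unif
        {u'. V (count A c) (win_prob (count A c) (\<lambda>k. x c (s c + k))) u' < V r y u}) \<partial>unif \<partial>?N)"
    proof (rule Fubini')
      show "(\<lambda>(x, u). \<Prod>c\<in>?B. emeasure unif
        {u'. V (count A c) (win_prob (count A c) (\<lambda>k. x c (s c + k))) u' < V r y u})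
          \<in> borel_measurable (?N \<Otimes>\<^sub>M unif)"
        unfolding split_beta'
      proof (rule borel_measurable_prod_ennreal)
        fix c assume c: "c \<in> ?B"
        show "(\<lambda>z. emeasure unif {u'. V (count A c) (win_prob (count A c) (\<lambda>k. fst z c (s c + k))) u' < V r y (snd z)})
          \<in> borel_measurable (?N \<Otimes>\<^sub>M unif)"
          by (rule emeasure_below_measurable'[OF measurable_compose[OF measurable_fst win_shift[OF c]]
                measurable_compose[OF measurable_snd Vy']])
      qed
    qed
    also have "\<dots> \<le> (\<integral>\<^sup>+x. ennreal (pmf (contest A (w x)) i) \<partial>?N)"
    proof (rule nn_integral_mono)
      fix x assume x: "x \<in> space ?N"
      have "(\<integral>\<^sup>+u. (\<Prod>c\<in>?B. emeasure unif
          {u'. V (count A c) (win_prob (count A c) (\<lambda>k. x c (s c + k))) u' < V r y u}) \<partial>unif) =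
        (\<integral>\<^sup>+u. (\<Prod>c\<in>?B. emeasure unif {u'. V (count A c) (w x c) u' < V (count A i) (w x i) u}) \<partial>unif)"
        by (intro nn_integral_cong prod.cong refl) (simp only: wi[OF x] wc[OF x] r_def)
      also have "\<dots> \<le> ennreal (pmf (contest A (w x)) i)"
        by (rule contest_ge[OF i])
      finally show "(\<integral>\<^sup>+u. (\<Prod>c\<in>?B. emeasure unif
          {u'. V (count A c) (win_prob (count A c) (\<lambda>k. x c (s c + k))) u' < V r y u}) \<partial>unif)
          \<le> ennreal (pmf (contest A (w x)) i)" .
    qed
    finally show ?thesis .
  qed
  also have "\<dots> = ennreal (\<integral>x. pmf (contest A (w x)) i \<partial>?N)"
    by (rule nn_integral_eq_integral[OF int AE_I2]) (rule pmf_nonneg)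
  finally show ?thesis by (simp add: ennreal_le_iff)
qed

end

section \<open>Negative association in products\<close>

locale na_win_dist = invariant_win_dist W for W +
  assumes NA: "\<And>n. n \<ge> 1 \<Longrightarrow> negatively_associated W (\<lambda>k x. x k) {..<n}"
begin

lemma integrable_W:
  fixes f :: "(nat \<Rightarrow> real) \<Rightarrow> real"
  assumes "f \<in> borel_measurable W" "\<And>x. x \<in> space W \<Longrightarrow> f x \<in> {0..1}"
  shows "integrable W f"
  by (rule integrable_const_bound[of _ 1]) (use assms in \<open>auto intro!: AE_I2\<close>)

text \<open>Transfers the property from functions of finitely many real coordinates to functions of
  sequences. The coordinatewise hypotheses force \<open>f\<close> and \<open>g\<close> to depend on
  \<open>D\<close> and \<open>E\<close> alone, so the remaining coordinates may be replaced by a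
  constant.\<close>

lemma NA_monotone:
  fixes f g :: "(nat \<Rightarrow> real) \<Rightarrow> real"
  assumes f: "f \<in> borel_measurable W" "\<And>x. x \<in> space W \<Longrightarrow> f x \<in> {0..1}"
    and g: "g \<in> borel_measurable W" "\<And>x. x \<in> space W \<Longrightarrow> g x \<in> {0..1}"
    and DE: "finite D" "finite E" "D \<inter> E = {}"
    and f_mono: "\<And>x y. x \<in> space W \<Longrightarrow> y \<in> space W \<Longrightarrow> (\<And>k. k \<in> D \<Longrightarrow> x k \<le> y k) \<Longrightarrow> f x \<le> f y"
    and g_mono: "\<And>x y. x \<in> space W \<Longrightarrow> y \<in> space W \<Longrightarrow> (\<And>k. k \<in> E \<Longrightarrow> x k \<le> y k) \<Longrightarrow> g x \<le> g y"
  shows "(\<integral>x. f x * g x \<partial>W) \<le> (\<integral>x. f x \<partial>W) * (\<integral>x. g x \<partial>W)"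
proof -
  define n where "n = Suc (Max (insert 0 (D \<union> E)))"
  have sub: "D \<subseteq> {..<n}" "E \<subseteq> {..<n}" using DE by (auto simp: n_def less_Suc_eq_le)
  \<comment> \<open>Test functions live on all real vectors, whereas \<open>f\<close> and
    \<open>g\<close> are controlled only on \<open>space W\<close>: \<open>emb\<close> clips to the
    unit interval and puts \<open>0\<close> outside \<open>A\<close>.\<close>
  define emb where "emb A z k = (if k \<in> A then min 1 (max 0 (z k)) else 0)" for A :: "nat set" and z :: "nat \<Rightarrow> real" and k
  have emb_meas: "emb A \<in> measurable (Pi\<^sub>M A (\<lambda>_. borel)) W" for A
  proof (rule measurable_into_W)
    fix k show "(\<lambda>z. emb A z k) \<in> borel_measurable (Pi\<^sub>M A (\<lambda>_. borel))"
      unfolding emb_def by (cases "k \<in> A") (simp_all, measurable)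
  qed (simp add: emb_def)
  have emb_space: "emb A z \<in> space W" for A z by (auto simp: space_W emb_def)
  have emb_eq: "emb A (restrict x A) k = x k" if "x \<in> space W" "k \<in> A" for A x k
    using that by (auto simp: emb_def space_W)
  have f_emb: "f (emb D (\<lambda>k\<in>D. x k)) = f x" if "x \<in> space W" for x
    using that emb_eq[OF that] by (intro antisym f_mono emb_space) auto
  have g_emb: "g (emb E (\<lambda>k\<in>E. x k)) = g x" if "x \<in> space W" for x
    using that emb_eq[OF that] by (intro antisym g_mono emb_space) auto
  have "integrable W (\<lambda>x. f x * g x)"
    by (rule integrable_W) (use f g in \<open>auto intro!: mult_le_one\<close>)
  note int = integrable_W[OF f] integrable_W[OF g] this
  have int_emb: "integrable W (\<lambda>x. f (emb D (\<lambda>k\<in>D. x k)))" "integrable W (\<lambda>x. g (emb E (\<lambda>k\<in>E. x k)))"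
    "integrable W (\<lambda>x. f (emb D (\<lambda>k\<in>D. x k)) * g (emb E (\<lambda>k\<in>E. x k)))"
    using int by (simp_all add: f_emb g_emb cong: Bochner_Integration.integrable_cong)
  have emb_mono: "emb A z k \<le> emb A z' k" if "z \<le> z'" for A z z' k
  proof -
    have "z k \<le> z' k" using that by (simp add: le_fun_def)
    then show ?thesis unfolding emb_def by simp linarith
  qed
  have "mono_on (space (Pi\<^sub>M D (\<lambda>_. borel :: real measure))) (\<lambda>z. f (emb D z))"
    by (intro mono_onI f_mono emb_space emb_mono)
  moreover have "mono_on (space (Pi\<^sub>M E (\<lambda>_. borel :: real measure))) (\<lambda>z. g (emb E z))"
    by (intro mono_onI g_mono emb_space emb_mono)
  ultimately have "covariance W (\<lambda>x. f (emb D (\<lambda>k\<in>D. x k))) (\<lambda>x. g (emb E (\<lambda>k\<in>E. x k))) \<le> 0"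
    using NA[of n, unfolded negatively_associated_def, rule_format,
        of D E "\<lambda>z. f (emb D z)" "\<lambda>z. g (emb E z)"]
      sub DE int_emb measurable_compose[OF emb_meas f(1)] measurable_compose[OF emb_meas g(1)]
    by (simp add: n_def)
  also have "covariance W (\<lambda>x. f (emb D (\<lambda>k\<in>D. x k))) (\<lambda>x. g (emb E (\<lambda>k\<in>E. x k)))
      = covariance W f g"
    unfolding covariance_def by (simp add: f_emb g_emb cong: Bochner_Integration.integral_cong)
  also have "covariance W f g = (\<integral>x. f x * g x \<partial>W) - (\<integral>x. f x \<partial>W) * (\<integral>x. g x \<partial>W)"
    unfolding covariance_def using int by (simp add: left_diff_distrib right_diff_distrib prob_space)
  finally show ?thesis by simp
qed

text \<open>Passing to \<open>1 - f\<close> and \<open>1 - g\<close> changes neither the covariance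
  nor the unit range, but reverses the monotonicity.\<close>

lemma NA_antimono:
  fixes f g :: "(nat \<Rightarrow> real) \<Rightarrow> real"
  assumes f: "f \<in> borel_measurable W" "\<And>x. x \<in> space W \<Longrightarrow> f x \<in> {0..1}"
    and g: "g \<in> borel_measurable W" "\<And>x. x \<in> space W \<Longrightarrow> g x \<in> {0..1}"
    and DE: "finite D" "finite E" "D \<inter> E = {}"
    and f_mono: "\<And>x y. x \<in> space W \<Longrightarrow> y \<in> space W \<Longrightarrow> (\<And>k. k \<in> D \<Longrightarrow> x k \<le> y k) \<Longrightarrow> f y \<le> f x"
    and g_mono: "\<And>x y. x \<in> space W \<Longrightarrow> y \<in> space W \<Longrightarrow> (\<And>k. k \<in> E \<Longrightarrow> x k \<le> y k) \<Longrightarrow> g y \<le> g x"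
  shows "(\<integral>x. f x * g x \<partial>W) \<le> (\<integral>x. f x \<partial>W) * (\<integral>x. g x \<partial>W)"
proof -
  have "integrable W (\<lambda>x. f x * g x)"
    by (rule integrable_W) (use f g in \<open>auto intro!: mult_le_one\<close>)
  note int = integrable_W[OF f] integrable_W[OF g] this
  have "(\<integral>x. (1 - f x) * (1 - g x) \<partial>W) \<le> (\<integral>x. 1 - f x \<partial>W) * (\<integral>x. 1 - g x \<partial>W)"
    using f g f_mono g_mono by (intro NA_monotone[OF _ _ _ _ DE]) (auto simp: diff_left_mono)
  then show ?thesis
    using int by (simp add: left_diff_distrib right_diff_distrib prob_space)
qed

lemma prod_one_minus:
  assumes "finite T"
  shows "(\<lambda>x. \<Prod>t\<in>T. 1 - x t) \<in> borel_measurable W"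
    and "\<And>x. x \<in> space W \<Longrightarrow> (\<Prod>t\<in>T. 1 - x t) \<in> {0..1}"
    and "\<And>x y. x \<in> space W \<Longrightarrow> y \<in> space W \<Longrightarrow> (\<And>k. k \<in> T \<Longrightarrow> x k \<le> y k) \<Longrightarrow>
      (\<Prod>t\<in>T. 1 - y t) \<le> (\<Prod>t\<in>T. 1 - x t)"
proof -
  show "(\<lambda>x. \<Prod>t\<in>T. 1 - x t) \<in> borel_measurable W" by measurable
  show "(\<Prod>t\<in>T. 1 - x t) \<in> {0..1}" if "x \<in> space W" for x
    using that by (auto simp: space_W intro!: prod_nonneg prod_le_1)
  show "(\<Prod>t\<in>T. 1 - y t) \<le> (\<Prod>t\<in>T. 1 - x t)"
    if "x \<in> space W" "y \<in> space W" "\<And>k. k \<in> T \<Longrightarrow> x k \<le> y k" for x y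
    using that by (intro prod_mono) (simp add: space_W)
qed

text \<open>By induction, the last block is separated from the union of the earlier ones; both
  products are nonincreasing and read disjoint indices.\<close>

lemma prod_blocks:
  assumes "\<And>l. l < (n::nat) \<Longrightarrow> finite (T l)" "disjoint_family_on T {..<n}"
  shows "(\<integral>x. (\<Prod>l<n. \<Prod>t\<in>T l. 1 - x t) \<partial>W) \<le> (\<Prod>l<n. \<integral>x. (\<Prod>t\<in>T l. 1 - x t) \<partial>W)"
  using assms
proof (induction n)
  case 0
  then show ?case by (simp add: prob_space)
next
  case (Suc n)
  have fin: "finite (T n)" "finite (\<Union>l<n. T l)" using Suc.prems by auto
  have disj: "disjoint_family_on T {..<n}"
    by (rule disjoint_family_on_mono[OF _ Suc.prems(2)]) auto
  have un: "(\<Prod>l<n. \<Prod>t\<in>T l. 1 - x t) = (\<Prod>t\<in>(\<Union>l<n. T l). 1 - x t)" for x :: "nat \<Rightarrow> real"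
    by (rule prod.UNION_disjoint[symmetric])
      (use Suc.prems(1) disj in \<open>simp_all add: disjoint_family_on_def\<close>)
  have dj: "(\<Union>l<n. T l) \<inter> T n = {}"
  proof -
    have "T l \<inter> T n = {}" if "l < n" for l
      using disjoint_family_onD[OF Suc.prems(2), of l n] that by simp
    then show ?thesis by blast
  qed
  have "(\<integral>x. (\<Prod>l<Suc n. \<Prod>t\<in>T l. 1 - x t) \<partial>W)
      = (\<integral>x. (\<Prod>t\<in>(\<Union>l<n. T l). 1 - x t) * (\<Prod>t\<in>T n. 1 - x t) \<partial>W)"
    by (simp add: un)
  also have "\<dots> \<le> (\<integral>x. (\<Prod>t\<in>(\<Union>l<n. T l). 1 - x t) \<partial>W) * (\<integral>x. (\<Prod>t\<in>T n. 1 - x t) \<partial>W)"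
    by (rule NA_antimono[OF prod_one_minus(1,2)[OF fin(2)] prod_one_minus(1,2)[OF fin(1)] fin(2,1) dj
          prod_one_minus(3)[OF fin(2)] prod_one_minus(3)[OF fin(1)]])
  also have "\<dots> \<le> (\<Prod>l<n. \<integral>x. (\<Prod>t\<in>T l. 1 - x t) \<partial>W) * (\<integral>x. (\<Prod>t\<in>T n. 1 - x t) \<partial>W)"
    unfolding un[symmetric]
  proof (rule mult_right_mono)
    show "(\<integral>x. (\<Prod>l<n. \<Prod>t\<in>T l. 1 - x t) \<partial>W) \<le> (\<Prod>l<n. \<integral>x. (\<Prod>t\<in>T l. 1 - x t) \<partial>W)"
      by (rule Suc.IH[OF Suc.prems(1) disj]) simp
    show "0 \<le> (\<integral>x. (\<Prod>t\<in>T n. 1 - x t) \<partial>W)"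
      using prod_one_minus(2)[OF fin(1)] by (intro integral_nonneg_AE AE_I2) simp
  qed
  finally show ?case by simp
qed

lemma integral_block:
  "(\<integral>x. (\<Prod>t\<in>{a..<a + n}. 1 - x t) \<partial>W) = (\<integral>x. (\<Prod>l<n. 1 - x l) \<partial>W)"
proof -
  have "(\<Prod>t\<in>{a..<a + n}. 1 - x t) = (\<Prod>l<n. 1 - x (a + l))" for x :: "nat \<Rightarrow> real"
    by (subst prod.atLeastLessThan_shift_0) (simp add: lessThan_atLeast0)
  then show ?thesis
    using integral_shift[OF prod_one_minus(1)[of "{..<n}"], of a] by simp
qed

section \<open>Families of independent sequences\<close>

lemma integrable_PiM:
  fixes f :: "('i \<Rightarrow> nat \<Rightarrow> real) \<Rightarrow> real"
  assumes "f \<in> borel_measurable (Pi\<^sub>M C (\<lambda>_. W))" "\<And>x. x \<in> space (Pi\<^sub>M C (\<lambda>_. W)) \<Longrightarrow> f x \<in> {0..1}"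
  shows "integrable (Pi\<^sub>M C (\<lambda>_. W)) f"
proof -
  interpret P: prob_space "Pi\<^sub>M C (\<lambda>_. W)" by (rule prob_space_PiM) (rule prob_space_axioms)
  show ?thesis by (rule P.integrable_const_bound[of _ 1]) (use assms in \<open>auto intro!: AE_I2\<close>)
qed

lemma fun_upd_space:
  assumes "X \<in> space (Pi\<^sub>M C (\<lambda>_. W))" "y \<in> space W"
  shows "X(b := y) \<in> space (Pi\<^sub>M (insert b C) (\<lambda>_. W))"
  using assms by (auto simp: space_PiM PiE_def extensional_def)

text \<open>The coordinatewise hypotheses on \<open>f\<close> and \<open>g\<close> say both that they are nondecreasing and that they
  depend only on the coordinates in \<open>D\<close> and \<open>E\<close>.\<close>

lemma NA_product:
  fixes f g :: "('i \<Rightarrow> nat \<Rightarrow> real) \<Rightarrow> real"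
  assumes "finite C"
    and "f \<in> borel_measurable (Pi\<^sub>M C (\<lambda>_. W))" "\<And>x. x \<in> space (Pi\<^sub>M C (\<lambda>_. W)) \<Longrightarrow> f x \<in> {0..1}"
    and "g \<in> borel_measurable (Pi\<^sub>M C (\<lambda>_. W))" "\<And>x. x \<in> space (Pi\<^sub>M C (\<lambda>_. W)) \<Longrightarrow> g x \<in> {0..1}"
    and "\<And>c. finite (D c)" "\<And>c. finite (E c)" "\<And>c. D c \<inter> E c = {}"
    and "\<And>x y. x \<in> space (Pi\<^sub>M C (\<lambda>_. W)) \<Longrightarrow> y \<in> space (Pi\<^sub>M C (\<lambda>_. W)) \<Longrightarrow>
      (\<And>c k. c \<in> C \<Longrightarrow> k \<in> D c \<Longrightarrow> x c k \<le> y c k) \<Longrightarrow> f x \<le> f y"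
    and "\<And>x y. x \<in> space (Pi\<^sub>M C (\<lambda>_. W)) \<Longrightarrow> y \<in> space (Pi\<^sub>M C (\<lambda>_. W)) \<Longrightarrow>
      (\<And>c k. c \<in> C \<Longrightarrow> k \<in> E c \<Longrightarrow> x c k \<le> y c k) \<Longrightarrow> g x \<le> g y"
  shows "(\<integral>x. f x * g x \<partial>Pi\<^sub>M C (\<lambda>_. W)) \<le> (\<integral>x. f x \<partial>Pi\<^sub>M C (\<lambda>_. W)) * (\<integral>x. g x \<partial>Pi\<^sub>M C (\<lambda>_. W))"
  using assms
proof (induction C arbitrary: f g rule: finite_induct)
  case empty
  interpret P: prob_space "Pi\<^sub>M {} (\<lambda>_. W)" by (rule prob_space_PiM) simp
  let ?u = "\<lambda>_::'i. undefined :: nat \<Rightarrow> real"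
  have "(\<integral>x. h x \<partial>Pi\<^sub>M {} (\<lambda>_. W)) = h ?u" for h :: "('i \<Rightarrow> nat \<Rightarrow> real) \<Rightarrow> real"
  proof -
    have "(\<integral>x. h x \<partial>Pi\<^sub>M {} (\<lambda>_. W)) = (\<integral>x. h ?u \<partial>Pi\<^sub>M ({} :: 'i set) (\<lambda>_. W))"
    proof (rule Bochner_Integration.integral_cong[OF refl])
      fix x assume "x \<in> space (Pi\<^sub>M {} (\<lambda>_. W) :: ('i \<Rightarrow> nat \<Rightarrow> real) measure)"
      then have "x = ?u" by (simp add: space_PiM)
      then show "h x = h ?u" by simp
    qed
    then show ?thesis by (simp add: P.prob_space)
  qed
  then show ?case by simp
next
  case (insert b C)
  let ?N = "Pi\<^sub>M C (\<lambda>_. W)" and ?N' = "Pi\<^sub>M (insert b C) (\<lambda>_. W)"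
  interpret prod: product_sigma_finite "\<lambda>_. W" by unfold_locales
  note f = insert.prems(1,2) and g = insert.prems(3,4)
  note f_mono = insert.prems(8) and g_mono = insert.prems(9)
  have upd: "(\<lambda>y. X(b := y)) \<in> measurable W ?N'" if "X \<in> space ?N" for X
    using measurable_component_update[OF that insert.hyps(2)] .
  have upd_pair: "(\<lambda>(X, y). X(b := y)) \<in> measurable (?N \<Otimes>\<^sub>M W) ?N'"
    by (rule measurable_add_dim)
  \<comment> \<open>\<open>F\<close> and \<open>G\<close> average out the sequence of
    \<open>b\<close>. For fixed \<open>X\<close>, negative association of \<open>W\<close> separates
    the two averages; as functions of \<open>X\<close> they inherit the hypotheses with the same
    \<open>D\<close> and \<open>E\<close>, so the induction hypothesis applies.\<close>
  define F where "F X = (\<integral>y. f (X(b := y)) \<partial>W)" for X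
  define G where "G X = (\<integral>y. g (X(b := y)) \<partial>W)" for X
  have int: "integrable W (\<lambda>y. h (X(b := y)))"
    if "h \<in> borel_measurable ?N'" "\<And>x. x \<in> space ?N' \<Longrightarrow> h x \<in> {0..1}" "X \<in> space ?N"
    for h :: "_ \<Rightarrow> real" and X
    by (rule integrable_W[OF measurable_compose[OF upd[OF that(3)] that(1)]])
      (rule that(2)[OF fun_upd_space[OF that(3)]])
  have avg_range: "(\<integral>y. h (X(b := y)) \<partial>W) \<in> {0..1}"
    if h: "h \<in> borel_measurable ?N'" "\<And>x. x \<in> space ?N' \<Longrightarrow> h x \<in> {0..1}" and X: "X \<in> space ?N"
    for h :: "_ \<Rightarrow> real" and X
  proof -
    have "h (X(b := y)) \<in> {0..1}" if "y \<in> space W" for y using h(2)[OF fun_upd_space[OF X that]] .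
    then have h01: "0 \<le> h (X(b := y))" "h (X(b := y)) \<le> 1" if "y \<in> space W" for y
      using that by auto
    have "(\<integral>y. h (X(b := y)) \<partial>W) \<le> (\<integral>y. 1 \<partial>W)"
      by (rule integral_mono[OF int[OF h X]]) (simp_all add: h01)
    moreover have "0 \<le> (\<integral>y. h (X(b := y)) \<partial>W)"
      by (intro integral_nonneg_AE AE_I2 h01)
    ultimately show ?thesis by (simp add: prob_space)
  qed
  have avg_meas: "(\<lambda>X. \<integral>y. h (X(b := y)) \<partial>W) \<in> borel_measurable ?N"
    if "h \<in> borel_measurable ?N'" for h :: "_ \<Rightarrow> real"
    using measurable_compose[OF upd_pair that]
    by (intro borel_measurable_lebesgue_integral) (simp add: split_beta')
  have avg_mono: "(\<integral>y. h (X(b := y)) \<partial>W) \<le> (\<integral>y. h (Y(b := y)) \<partial>W)"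
    if h: "h \<in> borel_measurable ?N'" "\<And>x. x \<in> space ?N' \<Longrightarrow> h x \<in> {0..1}"
      and XY: "X \<in> space ?N" "Y \<in> space ?N"
      and mono: "\<And>x y. x \<in> space ?N' \<Longrightarrow> y \<in> space ?N' \<Longrightarrow>
        (\<And>c k. c \<in> insert b C \<Longrightarrow> k \<in> S c \<Longrightarrow> x c k \<le> y c k) \<Longrightarrow> h x \<le> h y"
      and le: "\<And>c k. c \<in> C \<Longrightarrow> k \<in> S c \<Longrightarrow> X c k \<le> Y c k"
    for h :: "_ \<Rightarrow> real" and X Y S
  proof (rule integral_mono[OF int[OF h XY(1)] int[OF h XY(2)]])
    fix y assume y: "y \<in> space W"
    show "h (X(b := y)) \<le> h (Y(b := y))"
      by (rule mono[OF fun_upd_space[OF XY(1) y] fun_upd_space[OF XY(2) y]]) (use le in auto)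
  qed
  have F: "F \<in> borel_measurable ?N" "\<And>X. X \<in> space ?N \<Longrightarrow> F X \<in> {0..1}"
    unfolding F_def by (rule avg_meas[OF f(1)], rule avg_range[OF f])
  have G: "G \<in> borel_measurable ?N" "\<And>X. X \<in> space ?N \<Longrightarrow> G X \<in> {0..1}"
    unfolding G_def by (rule avg_meas[OF g(1)], rule avg_range[OF g])
  have fg: "(\<lambda>x. f x * g x) \<in> borel_measurable ?N'" "\<And>x. x \<in> space ?N' \<Longrightarrow> f x * g x \<in> {0..1}"
    using f g by (auto intro!: mult_le_one)
  have "(\<integral>x. f x * g x \<partial>?N') = (\<integral>X. (\<integral>y. f (X(b := y)) * g (X(b := y)) \<partial>W) \<partial>?N)"
    by (rule prod.product_integral_insert[OF insert.hyps(1,2) integrable_PiM[OF fg]])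
  also have "\<dots> \<le> (\<integral>X. F X * G X \<partial>?N)"
  proof (rule integral_mono)
    show "integrable ?N (\<lambda>X. \<integral>y. f (X(b := y)) * g (X(b := y)) \<partial>W)"
      by (rule integrable_PiM[OF avg_meas[OF fg(1)] avg_range[OF fg]])
    show "integrable ?N (\<lambda>X. F X * G X)"
      using F G by (intro integrable_PiM) (auto intro!: mult_le_one)
    fix X assume X: "X \<in> space ?N"
    show "(\<integral>y. f (X(b := y)) * g (X(b := y)) \<partial>W) \<le> F X * G X"
      unfolding F_def G_def
    proof (rule NA_monotone[OF measurable_compose[OF upd[OF X] f(1)] f(2)[OF fun_upd_space[OF X]]
          measurable_compose[OF upd[OF X] g(1)] g(2)[OF fun_upd_space[OF X]] insert.prems(5-7)[of b]])
      fix x y assume xy: "x \<in> space W" "y \<in> space W" and "\<And>k. k \<in> D b \<Longrightarrow> x k \<le> y k"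
      then show "f (X(b := x)) \<le> f (X(b := y))"
        by (intro f_mono fun_upd_space X) auto
    next
      fix x y assume xy: "x \<in> space W" "y \<in> space W" and "\<And>k. k \<in> E b \<Longrightarrow> x k \<le> y k"
      then show "g (X(b := x)) \<le> g (X(b := y))"
        by (intro g_mono fun_upd_space X) auto
    qed
  qed
  also have "\<dots> \<le> (\<integral>X. F X \<partial>?N) * (\<integral>X. G X \<partial>?N)"
  proof (rule insert.IH[OF F G insert.prems(5-7)])
    show "F X \<le> F Y" if "X \<in> space ?N" "Y \<in> space ?N" "\<And>c k. c \<in> C \<Longrightarrow> k \<in> D c \<Longrightarrow> X c k \<le> Y c k" for X Y
      unfolding F_def by (rule avg_mono[OF f that(1,2) f_mono that(3)])
    show "G X \<le> G Y" if "X \<in> space ?N" "Y \<in> space ?N" "\<And>c k. c \<in> C \<Longrightarrow> k \<in> E c \<Longrightarrow> X c k \<le> Y c k" for X Y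
      unfolding G_def by (rule avg_mono[OF g that(1,2) g_mono that(3)])
  qed
  also have "(\<integral>X. F X \<partial>?N) = (\<integral>x. f x \<partial>?N')"
    unfolding F_def by (rule prod.product_integral_insert[symmetric, OF insert.hyps(1,2) integrable_PiM[OF f]])
  also have "(\<integral>X. G X \<partial>?N) = (\<integral>x. g x \<partial>?N')"
    unfolding G_def by (rule prod.product_integral_insert[symmetric, OF insert.hyps(1,2) integrable_PiM[OF g]])
  finally show ?case .
qed

text \<open>One function is split off at a time. The product of the others is again nondecreasing,
  by nonnegativity, and reads the union of their index sets.\<close>

lemma NA_product_prod:
  fixes f :: "'j \<Rightarrow> ('i \<Rightarrow> nat \<Rightarrow> real) \<Rightarrow> real"
  assumes C: "finite C" and J: "finite J"
    and f: "\<And>j. j \<in> J \<Longrightarrow> f j \<in> borel_measurable (Pi\<^sub>M C (\<lambda>_. W))"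
      "\<And>j x. j \<in> J \<Longrightarrow> x \<in> space (Pi\<^sub>M C (\<lambda>_. W)) \<Longrightarrow> f j x \<in> {0..1}"
    and D: "\<And>j c. finite (D j c)"
      "\<And>j j' c. j \<in> J \<Longrightarrow> j' \<in> J \<Longrightarrow> j \<noteq> j' \<Longrightarrow> D j c \<inter> D j' c = {}"
    and mono: "\<And>j x y. j \<in> J \<Longrightarrow> x \<in> space (Pi\<^sub>M C (\<lambda>_. W)) \<Longrightarrow> y \<in> space (Pi\<^sub>M C (\<lambda>_. W)) \<Longrightarrow>
      (\<And>c k. c \<in> C \<Longrightarrow> k \<in> D j c \<Longrightarrow> x c k \<le> y c k) \<Longrightarrow> f j x \<le> f j y"
  shows "(\<integral>x. (\<Prod>j\<in>J. f j x) \<partial>Pi\<^sub>M C (\<lambda>_. W)) \<le> (\<Prod>j\<in>J. \<integral>x. f j x \<partial>Pi\<^sub>M C (\<lambda>_. W))"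
  using J f D(2) mono
proof (induction J rule: finite_induct)
  case empty
  interpret P: prob_space "Pi\<^sub>M C (\<lambda>_. W)" by (rule prob_space_PiM) (rule prob_space_axioms)
  show ?case by (simp add: P.prob_space)
next
  case (insert j J)
  let ?N = "Pi\<^sub>M C (\<lambda>_. W)"
  have "(\<integral>x. (\<Prod>j\<in>insert j J. f j x) \<partial>?N) = (\<integral>x. f j x * (\<Prod>j\<in>J. f j x) \<partial>?N)"
    using insert.hyps by simp
  also have "\<dots> \<le> (\<integral>x. f j x \<partial>?N) * (\<integral>x. (\<Prod>j\<in>J. f j x) \<partial>?N)"
  proof (rule NA_product[OF C, where D = "D j" and E = "\<lambda>c. \<Union>j'\<in>J. D j' c"])
    show "D j c \<inter> (\<Union>j'\<in>J. D j' c) = {}" for c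
      using insert.prems(3)[of j] insert.hyps(2) by fastforce
    show "f j x \<le> f j y" if "x \<in> space ?N" "y \<in> space ?N"
      "\<And>c k. c \<in> C \<Longrightarrow> k \<in> D j c \<Longrightarrow> x c k \<le> y c k" for x y
      by (rule insert.prems(4)[OF insertI1 that])
    show "(\<Prod>j\<in>J. f j x) \<le> (\<Prod>j\<in>J. f j y)" if x: "x \<in> space ?N" "y \<in> space ?N"
      and le: "\<And>c k. c \<in> C \<Longrightarrow> k \<in> (\<Union>j'\<in>J. D j' c) \<Longrightarrow> x c k \<le> y c k" for x y
    proof (rule prod_mono, rule conjI)
      fix i assume i: "i \<in> J"
      show "0 \<le> f i x" using insert.prems(2)[OF insertI2[OF i] x(1)] by simp
      show "f i x \<le> f i y"
        by (rule insert.prems(4)[OF insertI2[OF i] x]) (rule le, assumption, use i in blast)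
    qed
    show "(\<Prod>j\<in>J. f j x) \<in> {0..1}" if "x \<in> space ?N" for x
    proof -
      have "f i x \<in> {0..1}" if "i \<in> J" for i
        using insert.prems(2)[OF insertI2[OF that] \<open>x \<in> space ?N\<close>] .
      then show ?thesis by (auto intro!: prod_nonneg prod_le_1)
    qed
    show "(\<lambda>x. \<Prod>j\<in>J. f j x) \<in> borel_measurable ?N"
      using insert.prems(1) by (intro borel_measurable_prod) simp
    show "f j \<in> borel_measurable ?N" using insert.prems(1) by simp
    show "f j x \<in> {0..1}" if "x \<in> space ?N" for x using insert.prems(2)[OF insertI1 that] .
  qed (use insert.hyps D(1) in auto)
  also have "\<dots> \<le> (\<integral>x. f j x \<partial>?N) * (\<Prod>j\<in>J. \<integral>x. f j x \<partial>?N)"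
  proof (rule mult_left_mono)
    show "(\<integral>x. (\<Prod>j\<in>J. f j x) \<partial>?N) \<le> (\<Prod>j\<in>J. \<integral>x. f j x \<partial>?N)"
    proof (rule insert.IH)
      fix i assume i: "i \<in> J"
      show "f i \<in> borel_measurable ?N" by (rule insert.prems(1)[OF insertI2[OF i]])
      show "f i x \<in> {0..1}" if "x \<in> space ?N" for x by (rule insert.prems(2)[OF insertI2[OF i] that])
      show "D i c \<inter> D i' c = {}" if "i' \<in> J" "i \<noteq> i'" for i' c
        by (rule insert.prems(3)[OF insertI2[OF i] insertI2[OF that(1)] that(2)])
      show "f i x \<le> f i y" if "x \<in> space ?N" "y \<in> space ?N"
        "\<And>c k. c \<in> C \<Longrightarrow> k \<in> D i c \<Longrightarrow> x c k \<le> y c k" for x y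
        by (rule insert.prems(4)[OF insertI2[OF i] that])
    qed
    have "0 \<le> f j x" if "x \<in> space ?N" for x using insert.prems(2)[OF insertI1 that] by simp
    then show "0 \<le> (\<integral>x. f j x \<partial>?N)" by (intro integral_nonneg_AE AE_I2) auto
  qed
  finally show ?case using insert.hyps by simp
qed

end

section \<open>The OCS of a tournament\<close>

lemma start_index_cong:
  "(\<And>j'. j' < j \<Longrightarrow> A j' = A' j') \<Longrightarrow> start_index A j i = start_index A' j i"
  by (induction j) auto

lemma start_index_mono: "j \<le> j' \<Longrightarrow> start_index A j i \<le> start_index A j' i"
  by (rule lift_Suc_mono_le) simp_all

lemma desired_win_prob_cong:
  assumes "\<And>j'. j' \<le> j \<Longrightarrow> A j' = A' j'"
  shows "desired_win_prob A x j = desired_win_prob A' x j"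
  using start_index_cong[of j A A'] assms by (simp add: desired_win_prob_def cong: restrict_cong)

text \<open>The indices of the sequence of \<open>i\<close> that are read at step \<open>j\<close>.\<close>

definition draws :: "(nat \<Rightarrow> 'i multiset) \<Rightarrow> 'i \<Rightarrow> nat \<Rightarrow> nat set" where
  "draws A i j = {start_index A j i..<start_index A (Suc j) i}"

lemma finite_draws: "finite (draws A i j)"
  by (simp add: draws_def)

lemma draws_disjoint:
  assumes "j \<noteq> j'"
  shows "draws A i j \<inter> draws A i j' = {}"
proof -
  have "draws A i j \<inter> draws A i j' = {}" if "j < j'" for j j'
    using start_index_mono[of "Suc j" j' A i] that by (auto simp: draws_def)
  then show ?thesis using assms by (metis Int_commute linorder_neqE_nat)
qed

text \<open>Consecutive steps read a contiguous block, and contiguity is what lets shift invariance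
  turn the block into an initial segment.\<close>

lemma draws_union:
  assumes "j \<le> j'"
  shows "(\<Union>t\<in>{j..<j'}. draws A i t) = {start_index A j i..<start_index A j i + total_count A i {j..<j'}}"
proof -
  have "(\<Union>t\<in>{j..<j'}. draws A i t) = {start_index A j i..<start_index A j' i} \<and>
      start_index A j i + total_count A i {j..<j'} = start_index A j' i"
    using assms
  proof (induction j' rule: dec_induct)
    case base
    then show ?case by (simp add: total_count_def)
  next
    case (step n)
    have "start_index A j i \<le> start_index A n i" using step by (intro start_index_mono) simp
    then have "{start_index A j i..<start_index A n i} \<union> draws A i n
        = {start_index A j i..<start_index A (Suc n) i}"
      unfolding draws_def by (intro ivl_disj_un_two(3)) (simp_all only: start_index.simps le_add1)
    then show ?case
      using step by (simp add: atLeastLessThanSuc total_count_def Un_commute)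
  qed
  then show ?thesis by simp
qed

lemma prod_draws:
  "(\<Prod>t\<in>draws A i j. f t) = (\<Prod>l<count (A j) i. f (start_index A j i + l))"
  unfolding draws_def by (subst prod.atLeastLessThan_shift_0) (simp add: lessThan_atLeast0)

text \<open>The index set shows which variables are read and serves negative association; the
  shifted initial segment in \<open>desired_win_prob_win_prob\<close> serves shift
  invariance.\<close>

lemma desired_win_prob_draws:
  "c \<in># A j \<Longrightarrow> desired_win_prob A x j c = 1 - (\<Prod>t\<in>draws A c j. 1 - x c t)"
  by (simp add: desired_win_prob_def prod_draws)

lemma desired_win_prob_win_prob:
  "c \<in># A j \<Longrightarrow> desired_win_prob A x j c = win_prob (count (A j) c) (\<lambda>k. x c (start_index A j c + k))"
  by (simp add: desired_win_prob_def win_prob_def)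

text \<open>Collects what the analysis across rounds uses of a subroutine. In \<open>T_wins\<close>
  the offsets \<open>s\<close> are free, since every element has its own position in its sequence,
  and the probability of \<open>i\<close> is frozen at \<open>y\<close>.\<close>

locale tournament_OCS = na_win_dist W for W +
  fixes m :: nat and L :: "'i set" and T :: "'i multiset \<Rightarrow> ('i \<Rightarrow> real) \<Rightarrow> 'i pmf"
  assumes tour: "tournament_subroutine m L T"
    and T_antimono: "\<And>A i w w'. size A = m \<Longrightarrow> set_mset A \<subseteq> L \<Longrightarrow> i \<in># A \<Longrightarrow> w i = w' i \<Longrightarrow>
      (\<And>c. c \<in># A \<Longrightarrow> w c \<le> w' c) \<Longrightarrow> pmf (T A w') i \<le> pmf (T A w) i"
    and T_wins: "\<And>A i y w s. size A = m \<Longrightarrow> set_mset A \<subseteq> L \<Longrightarrow> i \<in># A \<Longrightarrow> y \<in> {0..1} \<Longrightarrow>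
      (\<And>x. x \<in> space (Pi\<^sub>M (set_mset A - {i}) (\<lambda>_. W)) \<Longrightarrow> w x i = y) \<Longrightarrow>
      (\<And>x c. x \<in> space (Pi\<^sub>M (set_mset A - {i}) (\<lambda>_. W)) \<Longrightarrow> c \<in> set_mset A - {i} \<Longrightarrow>
        w x c = win_prob (count A c) (\<lambda>k. x c (s c + k))) \<Longrightarrow>
      y \<le> (\<integral>x. pmf (T A (w x)) i \<partial>Pi\<^sub>M (set_mset A - {i}) (\<lambda>_. W))"
begin

lemma component_measurable [measurable]:
  assumes "c \<in> C"
  shows "(\<lambda>x. x c t) \<in> borel_measurable (Pi\<^sub>M C (\<lambda>_. W))"
  using measurable_compose[OF measurable_component_singleton[OF assms] measurable_W_component] .

lemma component_range:
  assumes "x \<in> space (Pi\<^sub>M C (\<lambda>_. W))" "c \<in> C"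
  shows "0 \<le> x c t" "x c t \<le> 1"
proof -
  have "x c \<in> space W" using assms by (auto simp: space_PiM)
  then show "0 \<le> x c t" "x c t \<le> 1" by (auto simp: space_W)
qed

lemma prod_draws_range:
  assumes "x \<in> space (Pi\<^sub>M C (\<lambda>_. W))" "c \<in> C"
  shows "(\<Prod>t\<in>S. 1 - x c t) \<in> {0..1}"
  using component_range[OF assms] by (auto intro!: prod_nonneg prod_le_1)

lemma desired_win_prob_in:
  assumes "x \<in> space (Pi\<^sub>M C (\<lambda>_. W))" "set_mset (A j) \<subseteq> C"
  shows "desired_win_prob A x j \<in> (\<Pi>\<^sub>E c\<in>set_mset (A j). {0..1})"
proof (rule PiE_I)
  fix c assume c: "c \<in># A j"
  then show "desired_win_prob A x j c \<in> {0..1}"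
    using prod_draws_range[OF assms(1), of c] assms(2) by (auto simp: desired_win_prob_draws)
qed (simp add: desired_win_prob_def)

lemma desired_win_prob_measurable:
  assumes "set_mset (A j) \<subseteq> C"
  shows "(\<lambda>x. desired_win_prob A x j)
    \<in> measurable (Pi\<^sub>M C (\<lambda>_. W)) (Pi\<^sub>M (set_mset (A j)) (\<lambda>_. unit_interval))"
proof (rule measurable_PiM_single')
  fix c assume c: "c \<in> set_mset (A j)"
  have "(\<lambda>x. 1 - (\<Prod>t\<in>draws A c j. 1 - x c t)) \<in> borel_measurable (Pi\<^sub>M C (\<lambda>_. W))"
    by (intro borel_measurable_diff borel_measurable_prod borel_measurable_const component_measurable
        subsetD[OF assms c])
  then have meas: "(\<lambda>x. desired_win_prob A x j c) \<in> borel_measurable (Pi\<^sub>M C (\<lambda>_. W))"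
    by (simp only: desired_win_prob_draws[where A = A and j = j, OF c])
  have range: "desired_win_prob A x j c \<in> {0..1}" if "x \<in> space (Pi\<^sub>M C (\<lambda>_. W))" for x
    by (rule PiE_mem[OF desired_win_prob_in[where A = A and j = j, OF that assms] c])
  show "(\<lambda>x. desired_win_prob A x j c) \<in> measurable (Pi\<^sub>M C (\<lambda>_. W)) unit_interval"
    by (rule measurable_restrict_space2[OF funcsetI meas]) (rule range)
next
  have "space unit_interval = {0..1}" by (simp add: space_restrict_space)
  then show "(\<lambda>x c. desired_win_prob A x j c)
      \<in> space (Pi\<^sub>M C (\<lambda>_. W)) \<rightarrow> (\<Pi>\<^sub>E c\<in>set_mset (A j). space unit_interval)"
    using desired_win_prob_in[where A = A and j = j, OF _ assms] by (intro funcsetI) (simp only:)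
qed

section \<open>The law of the winners for a fixed input\<close>

context
  fixes A :: "nat \<Rightarrow> 'i multiset"
  assumes A: "valid_input m L A"
begin

lemma size_A: "size (A j) = m" and A_sub: "set_mset (A j) \<subseteq> L"
  using A by (auto simp: valid_input_def)

abbreviation winner :: "('i \<Rightarrow> nat \<Rightarrow> real) \<Rightarrow> nat \<Rightarrow> 'i pmf" where
  "winner x j \<equiv> T (A j) (desired_win_prob A x j)"

lemma T_spec:
  "(\<forall>w \<in> (\<Pi>\<^sub>E i\<in>set_mset (A j). {0..1}). set_pmf (T (A j) w) \<subseteq> set_mset (A j)) \<and>
   (\<forall>i. (\<lambda>w. pmf (T (A j) w) i) \<in> borel_measurable (Pi\<^sub>M (set_mset (A j)) (\<lambda>_. unit_interval)))"
  by (rule mp[OF spec[OF tour[unfolded tournament_subroutine_def]] conjI[OF size_A A_sub]])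

lemma winner_measurable:
  assumes "set_mset (A j) \<subseteq> C"
  shows "(\<lambda>x. pmf (winner x j) i) \<in> borel_measurable (Pi\<^sub>M C (\<lambda>_. W))"
  by (rule measurable_compose[OF desired_win_prob_measurable[of A j C, OF assms]
        spec[OF conjunct2[OF T_spec[of j]]]])

lemma set_pmf_winner:
  assumes "x \<in> space (Pi\<^sub>M C (\<lambda>_. W))" "set_mset (A j) \<subseteq> C"
  shows "set_pmf (winner x j) \<subseteq> set_mset (A j)"
  by (rule bspec[OF conjunct1[OF T_spec[of j]] desired_win_prob_in[where A = A and j = j, OF assms]])

text \<open>The type of elements may be uncountable, but the winner lies in a finite multiset, so
  the probability of any \<open>E\<close> is a finite sum of point masses.\<close>

lemma emeasure_winner_measurable:
  "(\<lambda>x. emeasure (measure_pmf (winner x j)) E) \<in> borel_measurable (Pi\<^sub>M L (\<lambda>_. W))"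
proof -
  have eq: "emeasure (measure_pmf (winner x j)) E = ennreal (\<Sum>i\<in>E \<inter> set_mset (A j). pmf (winner x j) i)"
    if x: "x \<in> space (Pi\<^sub>M L (\<lambda>_. W))" for x
  proof -
    have "E \<inter> set_mset (A j) \<inter> set_pmf (winner x j) = E \<inter> set_pmf (winner x j)"
      using set_pmf_winner[OF x A_sub[of j]] by blast
    then have "measure (measure_pmf (winner x j)) E = measure (measure_pmf (winner x j)) (E \<inter> set_mset (A j))"
      by (metis measure_Int_set_pmf)
    also have "\<dots> = (\<Sum>i\<in>E \<inter> set_mset (A j). pmf (winner x j) i)"
      by (simp add: measure_measure_pmf_finite)
    finally show ?thesis by (simp add: measure_pmf.emeasure_eq_measure)
  qed
  have meas: "(\<lambda>x. ennreal (\<Sum>i\<in>E \<inter> set_mset (A j). pmf (winner x j) i)) \<in> borel_measurable (Pi\<^sub>M L (\<lambda>_. W))"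
    by (rule measurable_compose[OF borel_measurable_sum measurable_ennreal]) (rule winner_measurable[OF A_sub])
  show ?thesis by (rule measurable_cong[THEN iffD2, OF eq meas])
qed

abbreviation outcomes :: "(nat \<Rightarrow> 'i) measure" where
  "outcomes \<equiv> Pi\<^sub>M UNIV (\<lambda>_. count_space UNIV)"

abbreviation winners :: "('i \<Rightarrow> nat \<Rightarrow> real) \<Rightarrow> (nat \<Rightarrow> 'i) measure" where
  "winners x \<equiv> Pi\<^sub>M UNIV (\<lambda>j. measure_pmf (winner x j))"

lemma prob_space_winners: "prob_space (winners x)"
  by (rule prob_space_PiM) (rule prob_space_measure_pmf)

lemma sets_winners: "sets (winners x) = sets outcomes"
  by (rule sets_PiM_cong) simp_all

lemma prob_space_inputs: "prob_space (Pi\<^sub>M L (\<lambda>_. W))"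
  by (rule prob_space_PiM) (rule prob_space_axioms)

lemma emeasure_winners:
  assumes "finite J"
  shows "emeasure (winners x) (prod_emb UNIV (\<lambda>_. count_space UNIV) J (Pi\<^sub>E J E))
    = (\<Prod>j\<in>J. emeasure (measure_pmf (winner x j)) (E j))"
proof -
  have "prod_emb UNIV (\<lambda>_. count_space UNIV) J (Pi\<^sub>E J E)
      = prod_emb UNIV (\<lambda>j. measure_pmf (winner x j)) J (Pi\<^sub>E J E)"
    by (simp add: prod_emb_def)
  then show ?thesis using assms by (simp add: emeasure_PiM_emb prob_space_measure_pmf)
qed

text \<open>Cylinder sets form an intersection-stable generator, and on them the law is a finite
  product. This measurability makes the \<open>bind\<close> in \<open>OCS\<close> the intended
  mixture.\<close>

lemma winners_measurable: "winners \<in> measurable (Pi\<^sub>M L (\<lambda>_. W)) (subprob_algebra outcomes)"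
proof (rule measurable_subprob_algebra_generated[OF sets_PiM Int_stable_prod_algebra prod_algebra_sets_into_space])
  show "subprob_space (winners x)" for x
    by (rule prob_space_imp_subprob_space[OF prob_space_winners])
  have 1: "emeasure (winners x) (\<Pi>\<^sub>E i\<in>UNIV. space (count_space UNIV)) = 1" for x
  proof -
    have "(\<Pi>\<^sub>E i\<in>UNIV. space (count_space UNIV)) = space (winners x)" by (simp add: space_PiM)
    then show ?thesis using prob_space.emeasure_space_1[OF prob_space_winners[of x]] by simp
  qed
  show "(\<lambda>x. emeasure (winners x) (\<Pi>\<^sub>E i\<in>UNIV. space (count_space UNIV))) \<in> borel_measurable (Pi\<^sub>M L (\<lambda>_. W))"
    unfolding 1 by simp
  fix X assume "X \<in> prod_algebra (UNIV :: nat set) (\<lambda>_. count_space (UNIV :: 'i set) :: 'i measure)"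
  then obtain J E where X: "X = prod_emb UNIV (\<lambda>_. count_space UNIV) J (Pi\<^sub>E J E)" "finite J"
    by (auto elim!: prod_algebraE)
  show "(\<lambda>x. emeasure (winners x) X) \<in> borel_measurable (Pi\<^sub>M L (\<lambda>_. W))"
    unfolding X(1) emeasure_winners[OF X(2)]
    by (intro borel_measurable_prod_ennreal emeasure_winner_measurable)
qed (rule sets_winners)

lemma OCS_eq: "OCS L W T A = Giry_Monad.bind (Pi\<^sub>M L (\<lambda>_. W)) winners"
  by (simp add: OCS_def)

lemma space_inputs_ne: "space (Pi\<^sub>M L (\<lambda>_. W)) \<noteq> {}"
  by (rule prob_space.not_empty[OF prob_space_inputs])

lemma sets_OCS: "sets (OCS L W T A) = sets outcomes"
  unfolding OCS_eq by (rule sets_bind[OF sets_winners space_inputs_ne])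

lemma prob_space_OCS: "prob_space (OCS L W T A)"
  unfolding OCS_eq
  by (rule prob_space.prob_space_bind[OF prob_space_inputs _ winners_measurable]) (simp add: prob_space_winners)

lemma OCS_winner_in_input: "AE \<omega> in OCS L W T A. \<forall>j. \<omega> j \<in># A j"
  unfolding OCS_eq
proof (subst AE_bind[OF winners_measurable])
  have "(\<lambda>\<omega>. \<omega> j) \<in> measurable outcomes (count_space UNIV)" for j :: nat
    by measurable
  then have "Measurable.pred outcomes (\<lambda>\<omega>. \<omega> j \<in># A j)" for j
    by (rule measurable_compose[where g = "\<lambda>i. i \<in># A j"]) simp
  then show "Measurable.pred outcomes (\<lambda>\<omega>. \<forall>j. \<omega> j \<in># A j)"
    by measurable
  show "AE x in Pi\<^sub>M L (\<lambda>_. W). AE \<omega> in winners x. \<forall>j. \<omega> j \<in># A j"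
  proof (rule AE_I2)
    fix x assume x: "x \<in> space (Pi\<^sub>M L (\<lambda>_. W))"
    have "AE \<omega> in winners x. \<omega> j \<in># A j" for j
      by (rule AE_PiM_component[OF prob_space_measure_pmf])
        (use set_pmf_winner[OF x A_sub] in \<open>auto simp: AE_measure_pmf_iff\<close>)
    then show "AE \<omega> in winners x. \<forall>j. \<omega> j \<in># A j" by (simp add: AE_all_countable)
  qed
qed

text \<open>Each factor on the right reads the multisets up to its own step, so this form exhibits
  the online property.\<close>

lemma OCS_prefix:
  "distr (OCS L W T A) (Pi\<^sub>M {..<n} (\<lambda>_. count_space UNIV)) (\<lambda>\<omega>. restrict \<omega> {..<n})
    = Giry_Monad.bind (Pi\<^sub>M L (\<lambda>_. W)) (\<lambda>x. Pi\<^sub>M {..<n} (\<lambda>j. measure_pmf (winner x j)))"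
proof -
  let ?R = "Pi\<^sub>M {..<n} (\<lambda>_. count_space (UNIV :: 'i set))"
  have eq: "distr (winners x) ?R (\<lambda>\<omega>. restrict \<omega> {..<n}) = Pi\<^sub>M {..<n} (\<lambda>j. measure_pmf (winner x j))" for x
  proof -
    interpret product_prob_space "\<lambda>j. measure_pmf (winner x j)" UNIV
      by unfold_locales
    have "sets ?R = sets (Pi\<^sub>M {..<n} (\<lambda>j. measure_pmf (winner x j)))"
      by (rule sets_PiM_cong) simp_all
    then have "distr (winners x) ?R (\<lambda>\<omega>. restrict \<omega> {..<n})
        = distr (winners x) (Pi\<^sub>M {..<n} (\<lambda>j. measure_pmf (winner x j))) (\<lambda>\<omega>. restrict \<omega> {..<n})"
      by (intro distr_cong) simp_all
    then show ?thesis using distr_PiM_restrict_finite[of "{..<n}"] by simp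
  qed
  have "distr (OCS L W T A) ?R (\<lambda>\<omega>. restrict \<omega> {..<n})
      = Giry_Monad.bind (Pi\<^sub>M L (\<lambda>_. W)) (\<lambda>x. distr (winners x) ?R (\<lambda>\<omega>. restrict \<omega> {..<n}))"
    unfolding OCS_eq
    by (rule distr_bind[OF winners_measurable space_inputs_ne]) (rule measurable_restrict_subset, simp)
  then show ?thesis by (simp only: eq)
qed

text \<open>Given the draws the rounds are independent, so losing probabilities multiply under the
  integral.\<close>

lemma emeasure_never_wins:
  assumes "finite J"
  shows "emeasure (OCS L W T A) {\<omega> \<in> space (OCS L W T A). \<forall>j\<in>J. \<omega> j \<noteq> i}
    = (\<integral>\<^sup>+x. ennreal (\<Prod>j\<in>J. 1 - pmf (winner x j) i) \<partial>Pi\<^sub>M L (\<lambda>_. W))"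
proof -
  let ?E = "prod_emb UNIV (\<lambda>_. count_space UNIV) J (\<Pi>\<^sub>E j\<in>J. - {i})"
  have "space (OCS L W T A) = UNIV"
    using sets_eq_imp_space_eq[OF sets_OCS] by (simp add: space_PiM)
  then have "{\<omega> \<in> space (OCS L W T A). \<forall>j\<in>J. \<omega> j \<noteq> i} = ?E"
    by (auto simp: prod_emb_def PiE_iff)
  then have "emeasure (OCS L W T A) {\<omega> \<in> space (OCS L W T A). \<forall>j\<in>J. \<omega> j \<noteq> i}
      = (\<integral>\<^sup>+x. emeasure (winners x) ?E \<partial>Pi\<^sub>M L (\<lambda>_. W))"
    unfolding OCS_eq using assms
    by (simp only: ) (rule emeasure_bind[OF space_inputs_ne winners_measurable], rule sets_PiM_I, auto)
  also have "\<dots> = (\<integral>\<^sup>+x. ennreal (\<Prod>j\<in>J. 1 - pmf (winner x j) i) \<partial>Pi\<^sub>M L (\<lambda>_. W))"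
  proof (rule nn_integral_cong)
    fix x
    have "measure (measure_pmf p) (- {i}) = 1 - pmf p i" for p :: "'i pmf"
      using measure_pmf.prob_compl[of "{i}" p] by (simp add: Compl_eq_Diff_UNIV measure_pmf_single)
    then have "emeasure (measure_pmf (winner x j)) (- {i}) = ennreal (1 - pmf (winner x j) i)" for j
      by (simp add: measure_pmf.emeasure_eq_measure)
    then show "emeasure (winners x) ?E = ennreal (\<Prod>j\<in>J. 1 - pmf (winner x j) i)"
      unfolding emeasure_winners[OF assms] by (simp add: prod_ennreal pmf_le_1)
  qed
  finally show ?thesis .
qed

lemma winner_restrict: "set_mset (A j) \<subseteq> C \<Longrightarrow> winner (restrict x C) j = winner x j"
  by (rule arg_cong[of _ _ "T (A j)"], unfold desired_win_prob_def, rule restrict_ext) auto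

section \<open>The probability that a fixed element never wins\<close>

context
  fixes i :: 'i
  assumes i: "i \<in> L"
begin

text \<open>\<open>C'\<close> may collect the elements of several rounds, which puts all rounds on
  one product space. The winner at step \<open>j\<close> reads only the elements of
  \<open>A j\<close>, so the mean reduces to a marginal one, to which \<open>T_wins\<close>
  applies.\<close>

lemma loss_average:
  assumes j: "i \<in># A j" and C': "finite C'" "i \<notin> C'" "set_mset (A j) \<subseteq> insert i C'" "C' \<subseteq> L"
    and y: "y \<in> space W"
  shows "(\<integral>X. 1 - pmf (winner (X(i := y)) j) i \<partial>Pi\<^sub>M C' (\<lambda>_. W)) \<le> (\<Prod>t\<in>draws A i j. 1 - y t)"
proof -
  let ?N = "Pi\<^sub>M C' (\<lambda>_. W)" and ?B = "set_mset (A j) - {i}"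
  interpret N: prob_space ?N by (rule prob_space_PiM) (rule prob_space_axioms)
  interpret P: product_prob_space "\<lambda>_. W" C' by unfold_locales
  define p where "p X = pmf (winner (X(i := y)) j) i" for X
  have upd: "(\<lambda>X. X(i := y)) \<in> measurable (Pi\<^sub>M K (\<lambda>_. W)) (Pi\<^sub>M (insert i K) (\<lambda>_. W))" if "i \<notin> K" for K
    using measurable_compose[OF measurable_Pair2'[OF y] measurable_add_dim[of i K "\<lambda>_. W"]] by simp
  have p_meas: "p \<in> borel_measurable (Pi\<^sub>M K (\<lambda>_. W))" if "i \<notin> K" "set_mset (A j) \<subseteq> insert i K" for K
    unfolding p_def by (rule measurable_compose[OF upd[OF that(1)] winner_measurable[OF that(2)]])
  have sub: "?B \<subseteq> C'" using C' by auto
  have p_restrict: "p (restrict X ?B) = p X" for X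
  proof -
    have "winner ((restrict X ?B)(i := y)) j = winner (X(i := y)) j"
      by (rule arg_cong[of _ _ "T (A j)"], unfold desired_win_prob_def, rule restrict_ext) simp
    then show ?thesis by (simp add: p_def)
  qed
  have "1 - (\<Prod>t\<in>draws A i j. 1 - y t) \<le> (\<integral>X. p X \<partial>Pi\<^sub>M ?B (\<lambda>_. W))"
    unfolding p_def
  proof (rule T_wins[OF size_A A_sub j])
    show "1 - (\<Prod>t\<in>draws A i j. 1 - y t) \<in> {0..1}"
      using prod_one_minus(2)[OF finite_draws[of A i j] y] by simp
    show "desired_win_prob A (X(i := y)) j i = 1 - (\<Prod>t\<in>draws A i j. 1 - y t)" for X
      using j by (simp add: desired_win_prob_draws)
    show "desired_win_prob A (X(i := y)) j c = win_prob (count (A j) c) (\<lambda>k. X c (start_index A j c + k))"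
      if "c \<in> ?B" for X c
      using that by (simp add: desired_win_prob_win_prob)
  qed
  also have "\<dots> = (\<integral>X. p (restrict X ?B) \<partial>?N)"
  proof -
    have "(\<integral>X. p X \<partial>Pi\<^sub>M ?B (\<lambda>_. W)) = (\<integral>X. p X \<partial>distr ?N (Pi\<^sub>M ?B (\<lambda>_. W)) (\<lambda>X. restrict X ?B))"
      using P.distr_PiM_restrict_finite[OF finite_subset[OF sub C'(1)] sub] by simp
    also have "\<dots> = (\<integral>X. p (restrict X ?B) \<partial>?N)"
      by (rule integral_distr[OF measurable_restrict_subset[OF sub]], rule p_meas) auto
    finally show ?thesis .
  qed
  also have "\<dots> = (\<integral>X. p X \<partial>?N)" by (simp only: p_restrict)
  finally have "1 - (\<Prod>t\<in>draws A i j. 1 - y t) \<le> (\<integral>X. p X \<partial>?N)" .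
  moreover have "integrable ?N p"
    by (rule integrable_PiM[OF p_meas[OF C'(2,3)]]) (simp add: p_def pmf_le_1)
  ultimately show ?thesis unfolding p_def[symmetric] by (simp add: N.prob_space)
qed

text \<open>Larger variables of the opponents raise their desired probabilities while that of
  \<open>i\<close> stays determined by \<open>y\<close>, so \<open>T_antimono\<close> applies.
  Comparing only the indices read at step \<open>j\<close> yields disjoint index sets for different
  rounds.\<close>

lemma loss_mono:
  assumes j: "i \<in># A j" "set_mset (A j) \<subseteq> insert i C'" and y: "y \<in> space W"
    and X: "X \<in> space (Pi\<^sub>M C' (\<lambda>_. W))" "X' \<in> space (Pi\<^sub>M C' (\<lambda>_. W))"
    and le: "\<And>c t. c \<in> C' \<Longrightarrow> t \<in> draws A c j \<Longrightarrow> X c t \<le> X' c t"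
  shows "1 - pmf (winner (X(i := y)) j) i \<le> 1 - pmf (winner (X'(i := y)) j) i"
proof -
  have "desired_win_prob A (X(i := y)) j c \<le> desired_win_prob A (X'(i := y)) j c" if c: "c \<in># A j" for c
  proof (cases "c = i")
    case True
    then show ?thesis using c by (simp add: desired_win_prob_draws)
  next
    case False
    then have c': "c \<in> C'" using c j by auto
    have "(\<Prod>t\<in>draws A c j. 1 - X' c t) \<le> (\<Prod>t\<in>draws A c j. 1 - X c t)"
      using le[OF c'] component_range[OF X(2) c'] by (intro prod_mono) auto
    then show ?thesis using c False by (simp add: desired_win_prob_draws)
  qed
  then have "pmf (winner (X'(i := y)) j) i \<le> pmf (winner (X(i := y)) j) i"
    using j(1) by (intro T_antimono size_A A_sub) (simp_all add: desired_win_prob_draws)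
  then show ?thesis by simp
qed

lemma loss_product:
  assumes J: "finite J" "\<And>j. j \<in> J \<Longrightarrow> i \<in># A j"
    and C': "finite C'" "i \<notin> C'" "\<And>j. j \<in> J \<Longrightarrow> set_mset (A j) \<subseteq> insert i C'" "C' \<subseteq> L"
    and y: "y \<in> space W"
  shows "(\<integral>\<^sup>+X. ennreal (\<Prod>j\<in>J. 1 - pmf (winner (X(i := y)) j) i) \<partial>Pi\<^sub>M C' (\<lambda>_. W))
    \<le> ennreal (\<Prod>j\<in>J. \<Prod>t\<in>draws A i j. 1 - y t)"
proof -
  let ?N = "Pi\<^sub>M C' (\<lambda>_. W)"
  define g where "g j X = 1 - pmf (winner (X(i := y)) j) i" for j X
  have g_range: "g j X \<in> {0..1}" for j X by (simp add: g_def pmf_le_1)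
  have upd: "(\<lambda>X. X(i := y)) \<in> measurable ?N (Pi\<^sub>M (insert i C') (\<lambda>_. W))"
    using measurable_compose[OF measurable_Pair2'[OF y] measurable_add_dim[of i C' "\<lambda>_. W"]] by simp
  have g_meas: "g j \<in> borel_measurable ?N" if "j \<in> J" for j
    unfolding g_def
    by (rule borel_measurable_diff[OF borel_measurable_const
          measurable_compose[OF upd winner_measurable[OF C'(3)[OF that]]]])
  have prod_meas: "(\<lambda>X. \<Prod>j\<in>J. g j X) \<in> borel_measurable ?N"
    by (rule borel_measurable_prod) (rule g_meas)
  have prod_range: "(\<Prod>j\<in>J. g j X) \<in> {0..1}" for X
    using g_range by (auto intro!: prod_nonneg prod_le_1)
  have "(\<integral>\<^sup>+X. ennreal (\<Prod>j\<in>J. g j X) \<partial>?N) = ennreal (\<integral>X. (\<Prod>j\<in>J. g j X) \<partial>?N)"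
    by (rule nn_integral_eq_integral[OF integrable_PiM[OF prod_meas prod_range] AE_I2])
      (use prod_range in simp)
  also have "\<dots> \<le> ennreal (\<Prod>j\<in>J. \<Prod>t\<in>draws A i j. 1 - y t)"
  proof (rule ennreal_leI)
    have "(\<integral>X. (\<Prod>j\<in>J. g j X) \<partial>?N) \<le> (\<Prod>j\<in>J. \<integral>X. g j X \<partial>?N)"
    proof (rule NA_product_prod[OF C'(1) J(1) g_meas g_range])
      show "finite (draws A c j)" for c j by (rule finite_draws)
      show "draws A c j \<inter> draws A c j' = {}" if "j \<noteq> j'" for c j j' by (rule draws_disjoint[OF that])
      show "g j X \<le> g j X'" if "j \<in> J" "X \<in> space ?N" "X' \<in> space ?N"
        "\<And>c t. c \<in> C' \<Longrightarrow> t \<in> draws A c j \<Longrightarrow> X c t \<le> X' c t" for j X X'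
        unfolding g_def by (rule loss_mono[OF J(2)[OF that(1)] C'(3)[OF that(1)] y that(2-4)])
    qed
    also have "\<dots> \<le> (\<Prod>j\<in>J. \<Prod>t\<in>draws A i j. 1 - y t)"
    proof (rule prod_mono, rule conjI)
      fix j assume j: "j \<in> J"
      show "0 \<le> (\<integral>X. g j X \<partial>?N)" using g_range by (intro integral_nonneg_AE AE_I2) simp
      show "(\<integral>X. g j X \<partial>?N) \<le> (\<Prod>t\<in>draws A i j. 1 - y t)"
        unfolding g_def by (rule loss_average[OF J(2)[OF j] C'(1,2) C'(3)[OF j] C'(4) y])
    qed
    finally show "(\<integral>X. (\<Prod>j\<in>J. g j X) \<partial>?N) \<le> (\<Prod>j\<in>J. \<Prod>t\<in>draws A i j. 1 - y t)" .
  qed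
  finally show ?thesis unfolding g_def .
qed

lemma never_wins_le:
  assumes J: "finite J"
  shows "(\<integral>\<^sup>+x. ennreal (\<Prod>j\<in>J. 1 - pmf (winner x j) i) \<partial>Pi\<^sub>M L (\<lambda>_. W))
    \<le> (\<integral>\<^sup>+y. ennreal (\<Prod>j\<in>J. \<Prod>t\<in>draws A i j. 1 - y t) \<partial>W)"
proof -
  \<comment> \<open>Rounds without \<open>i\<close> contribute the factor \<open>1\<close> on both
    sides: \<open>i\<close> cannot win there, and no index of its sequence is read.\<close>
  define J0 where "J0 = {j \<in> J. i \<in># A j}"
  \<comment> \<open>\<open>L\<close> may be infinite, but finitely many rounds involve finitely many
    elements; restricting to these makes the induction over coordinates in \<open>NA_product\<close>
    available.\<close>
  define C' where "C' = (\<Union>j\<in>J. set_mset (A j)) - {i}"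
  define C where "C = insert i C'"
  have C': "finite C'" "i \<notin> C'" "C' \<subseteq> L" using J A_sub by (auto simp: C'_def)
  have C: "finite C" "C \<subseteq> L" using C' i by (auto simp: C_def)
  have A_C: "set_mset (A j) \<subseteq> C" if "j \<in> J" for j using that by (auto simp: C_def C'_def)
  have J0: "finite J0" "J0 \<subseteq> J" "\<And>j. j \<in> J0 \<Longrightarrow> i \<in># A j" using J by (auto simp: J0_def)
  interpret P: product_prob_space "\<lambda>_. W" L by unfold_locales
  define G where "G x = ennreal (\<Prod>j\<in>J0. 1 - pmf (winner x j) i)" for x
  have G_meas: "G \<in> borel_measurable (Pi\<^sub>M C (\<lambda>_. W))"
    unfolding G_def
    by (rule measurable_compose[OF borel_measurable_prod measurable_ennreal])
      (rule borel_measurable_diff[OF borel_measurable_const winner_measurable[OF A_C[OF subsetD[OF J0(2)]]]])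
  have G_restrict: "ennreal (\<Prod>j\<in>J. 1 - pmf (winner x j) i) = G (restrict x C)"
    if x: "x \<in> space (Pi\<^sub>M L (\<lambda>_. W))" for x
  proof -
    have "(\<Prod>j\<in>J. 1 - pmf (winner x j) i) = (\<Prod>j\<in>J0. 1 - pmf (winner x j) i)"
    proof (rule prod.mono_neutral_right[OF J J0(2)], rule ballI)
      fix j assume "j \<in> J - J0"
      then have "i \<notin> set_pmf (winner x j)" using set_pmf_winner[OF x A_sub, of j] by (auto simp: J0_def)
      then show "1 - pmf (winner x j) i = 1" by (simp add: set_pmf_iff)
    qed
    also have "\<dots> = (\<Prod>j\<in>J0. 1 - pmf (winner (restrict x C) j) i)"
      using J0(2) A_C by (intro prod.cong refl) (simp add: winner_restrict subsetD)
    finally show ?thesis by (simp add: G_def)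
  qed
  have J_eq: "(\<Prod>j\<in>J0. \<Prod>t\<in>draws A i j. 1 - y t) = (\<Prod>j\<in>J. \<Prod>t\<in>draws A i j. 1 - y t)" for y :: "nat \<Rightarrow> real"
    by (rule prod.mono_neutral_left[OF J J0(2)]) (auto simp: J0_def draws_def not_in_iff)
  have "(\<integral>\<^sup>+x. ennreal (\<Prod>j\<in>J. 1 - pmf (winner x j) i) \<partial>Pi\<^sub>M L (\<lambda>_. W))
      = (\<integral>\<^sup>+x. G (restrict x C) \<partial>Pi\<^sub>M L (\<lambda>_. W))"
    by (rule nn_integral_cong) (rule G_restrict)
  also have "\<dots> = (\<integral>\<^sup>+x. G x \<partial>distr (Pi\<^sub>M L (\<lambda>_. W)) (Pi\<^sub>M C (\<lambda>_. W)) (\<lambda>x. restrict x C))"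
    by (rule nn_integral_distr[symmetric, OF measurable_restrict_subset[OF C(2)]]) (simp add: G_meas)
  also have "\<dots> = (\<integral>\<^sup>+x. G x \<partial>Pi\<^sub>M (insert i C') (\<lambda>_. W))"
    unfolding P.distr_PiM_restrict_finite[OF C] by (simp only: C_def)
  \<comment> \<open>The sequence of \<open>i\<close> becomes the outer variable, so that the bound
    for fixed \<open>y\<close> can be inserted.\<close>
  also have "\<dots> = (\<integral>\<^sup>+y. \<integral>\<^sup>+X. G (X(i := y)) \<partial>Pi\<^sub>M C' (\<lambda>_. W) \<partial>W)"
    by (rule P.product_nn_integral_insert_rev[OF C'(1,2) G_meas[unfolded C_def]])
  also have "\<dots> \<le> (\<integral>\<^sup>+y. ennreal (\<Prod>j\<in>J0. \<Prod>t\<in>draws A i j. 1 - y t) \<partial>W)"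
    unfolding G_def
  proof (rule nn_integral_mono)
    fix y assume y: "y \<in> space W"
    show "(\<integral>\<^sup>+X. ennreal (\<Prod>j\<in>J0. 1 - pmf (winner (X(i := y)) j) i) \<partial>Pi\<^sub>M C' (\<lambda>_. W))
        \<le> ennreal (\<Prod>j\<in>J0. \<Prod>t\<in>draws A i j. 1 - y t)"
      by (rule loss_product[OF J0(1,3) C'(1,2) A_C[OF subsetD[OF J0(2)], unfolded C_def] C'(3) y])
  qed
  finally show ?thesis by (simp only: J_eq)
qed

text \<open>The bound of \<open>never_wins_le\<close> is regrouped by the sets \<open>S l\<close>.
  \<open>prod_blocks\<close> separates the groups, and each is a contiguous block whose mean depends
  only on its length.\<close>

lemma never_wins_consecutive:
  assumes S: "\<And>l. l < (k::nat) \<Longrightarrow> consecutive (S l)" "disjoint_family_on S {..<k}"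
  shows "measure (OCS L W T A) {\<omega> \<in> space (OCS L W T A). \<forall>j\<in>(\<Union>l<k. S l). \<omega> j \<noteq> i}
    \<le> (\<Prod>l<k. \<integral>x. (\<Prod>n<total_count A i (S l). 1 - x n) \<partial>W)"
proof -
  interpret O: prob_space "OCS L W T A" by (rule prob_space_OCS)
  define J where "J = (\<Union>l<k. S l)"
  define D where "D l = (\<Union>j\<in>S l. draws A i j)" for l
  have S_fin: "finite (S l)" if "l < k" for l using S(1)[OF that] unfolding consecutive_def by auto
  have S_disj: "S l \<inter> S l' = {}" if "l < k" "l' < k" "l \<noteq> l'" for l l'
    by (rule disjoint_family_onD[OF S(2)]) (use that in simp_all)
  have J: "finite J" unfolding J_def by (rule finite_UN_I) (simp_all add: S_fin)
  have D_fin: "finite (D l)" if "l < k" for l unfolding D_def by (rule finite_UN_I[OF S_fin[OF that] finite_draws])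
  have D_disj: "disjoint_family_on D {..<k}"
    unfolding disjoint_family_on_def
  proof (intro ballI impI)
    fix l l' assume l: "l \<in> {..<k}" "l' \<in> {..<k}" "l \<noteq> l'"
    then have "S l \<inter> S l' = {}" by (intro S_disj) simp_all
    then have "draws A i j \<inter> draws A i j' = {}" if "j \<in> S l" "j' \<in> S l'" for j j'
      using that by (intro draws_disjoint) auto
    then show "D l \<inter> D l' = {}" unfolding D_def by blast
  qed
  have D_int: "(\<integral>x. (\<Prod>t\<in>D l. 1 - x t) \<partial>W) = (\<integral>x. (\<Prod>n<total_count A i (S l). 1 - x n) \<partial>W)"
    if l: "l < k" for l
  proof -
    obtain a b where ab: "a < b" "S l = {a..b}" using S(1)[OF l] unfolding consecutive_def by blast
    \<comment> \<open>The closed interval of steps becomes a half-open one with end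
      \<open>Suc b\<close>, the form in which \<open>draws_union\<close> is stated.\<close>
    have "S l = {a..<Suc b}" unfolding ab(2) by (rule atLeastLessThanSuc_atLeastAtMost[symmetric])
    then have "D l = {start_index A a i..<start_index A a i + total_count A i (S l)}"
      using draws_union[of a "Suc b" A i] ab(1) by (simp only: D_def less_imp_le le_SucI)
    then show ?thesis by (simp only: integral_block)
  qed
  have prod_eq: "(\<Prod>j\<in>J. \<Prod>t\<in>draws A i j. 1 - y t) = (\<Prod>l<k. \<Prod>t\<in>D l. 1 - y t)" for y :: "nat \<Rightarrow> real"
  proof -
    have "(\<Prod>j\<in>J. \<Prod>t\<in>draws A i j. 1 - y t) = (\<Prod>l<k. \<Prod>j\<in>S l. \<Prod>t\<in>draws A i j. 1 - y t)"
      unfolding J_def by (rule prod.UNION_disjoint) (simp_all add: S_fin S_disj)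
    also have "\<dots> = (\<Prod>l<k. \<Prod>t\<in>D l. 1 - y t)"
    proof (rule prod.cong[OF refl])
      fix l assume "l \<in> {..<k}"
      then show "(\<Prod>j\<in>S l. \<Prod>t\<in>draws A i j. 1 - y t) = (\<Prod>t\<in>D l. 1 - y t)"
        unfolding D_def by (intro prod.UNION_disjoint[symmetric]) (simp_all add: S_fin finite_draws draws_disjoint)
    qed
    finally show ?thesis .
  qed
  have meas: "(\<lambda>x. \<Prod>l<k. \<Prod>t\<in>D l. 1 - x t) \<in> borel_measurable W" by measurable
  have range: "(\<Prod>l<k. \<Prod>t\<in>D l. 1 - x t) \<in> {0..1}" if x: "x \<in> space W" for x
    using prod_nonneg[of "{..<k}" "\<lambda>l. \<Prod>t\<in>D l. 1 - x t"] prod_le_1[of "{..<k}" "\<lambda>l. \<Prod>t\<in>D l. 1 - x t"]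
      prod_one_minus(2)[OF D_fin x] by simp
  have "ennreal (measure (OCS L W T A) {\<omega> \<in> space (OCS L W T A). \<forall>j\<in>J. \<omega> j \<noteq> i})
      \<le> (\<integral>\<^sup>+y. ennreal (\<Prod>l<k. \<Prod>t\<in>D l. 1 - y t) \<partial>W)"
    using never_wins_le[OF J] unfolding O.emeasure_eq_measure[symmetric] emeasure_never_wins[OF J] prod_eq .
  also have "\<dots> = ennreal (\<integral>y. (\<Prod>l<k. \<Prod>t\<in>D l. 1 - y t) \<partial>W)"
    by (rule nn_integral_eq_integral[OF integrable_W[OF meas range] AE_I2]) (use range in simp_all)
  finally have "measure (OCS L W T A) {\<omega> \<in> space (OCS L W T A). \<forall>j\<in>J. \<omega> j \<noteq> i}
      \<le> (\<integral>y. (\<Prod>l<k. \<Prod>t\<in>D l. 1 - y t) \<partial>W)"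
    by (rule ennreal_le_iff[THEN iffD1, rotated]) (intro integral_nonneg_AE AE_I2, use range in simp)
  also have "\<dots> \<le> (\<Prod>l<k. \<integral>x. (\<Prod>t\<in>D l. 1 - x t) \<partial>W)"
    by (rule prod_blocks[OF D_fin D_disj])
  also have "\<dots> = (\<Prod>l<k. \<integral>x. (\<Prod>n<total_count A i (S l). 1 - x n) \<partial>W)"
    by (rule prod.cong[OF refl]) (simp add: D_int)
  finally show ?thesis unfolding J_def .
qed

end

end

lemma F_discrete_OCS:
  "F_discrete_OCS (\<lambda>n. \<integral>x. (\<Prod>l<n. (1 - x l)) \<partial>W) m L (OCS L W T)"
  unfolding F_discrete_OCS_def discrete_OCS_def
proof (intro conjI allI impI; (elim conjE)?)
  fix A assume A: "valid_input m L A"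
  show "prob_space (OCS L W T A)" by (rule prob_space_OCS[OF A])
  show "sets (OCS L W T A) = sets (Pi\<^sub>M UNIV (\<lambda>_. count_space UNIV))" by (rule sets_OCS[OF A])
  show "AE \<omega> in OCS L W T A. \<forall>j. \<omega> j \<in># A j" by (rule OCS_winner_in_input[OF A])
next
  fix A A' n
  assume A: "valid_input m L A" "valid_input m L A'" and eq: "\<forall>j<n. A j = A' j"
  have "T (A j) (desired_win_prob A x j) = T (A' j) (desired_win_prob A' x j)" if "j < n" for x j
    using desired_win_prob_cong[of j A A' x] eq that by simp
  then have "Pi\<^sub>M {..<n} (\<lambda>j. measure_pmf (T (A j) (desired_win_prob A x j)))
      = Pi\<^sub>M {..<n} (\<lambda>j. measure_pmf (T (A' j) (desired_win_prob A' x j)))" for x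
    by (intro PiM_cong) auto
  then show "distr (OCS L W T A) (Pi\<^sub>M {..<n} (\<lambda>_. count_space UNIV)) (\<lambda>\<omega>. restrict \<omega> {..<n}) =
      distr (OCS L W T A') (Pi\<^sub>M {..<n} (\<lambda>_. count_space UNIV)) (\<lambda>\<omega>. restrict \<omega> {..<n})"
    by (simp only: OCS_prefix[OF A(1)] OCS_prefix[OF A(2)])
next
  fix A i k and S :: "nat \<Rightarrow> nat set"
  assume A: "valid_input m L A" and i: "i \<in> L"
    and S: "\<forall>l<k. consecutive (S l)" "disjoint_family_on S {..<k}"
  have "consecutive (S l)" if "l < k" for l using S(1) that by simp
  from never_wins_consecutive[OF A i this S(2)]
  show "measure (OCS L W T A) {\<omega> \<in> space (OCS L W T A). \<forall>j\<in>(\<Union>l<k. S l). \<omega> j \<noteq> i}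
    \<le> (\<Prod>l<k. \<integral>x. (\<Prod>n<total_count A i (S l). 1 - x n) \<partial>W)" .
qed

end

theorem mainTheorem6:
  fixes m :: nat and L :: "'i set" and W :: "(nat \<Rightarrow> real) measure"
  assumes "m \<ge> 2"
    and "win_distribution W"
    and "\<And>n. n \<ge> 1 \<Longrightarrow> negatively_associated W (\<lambda>k x. x k) {..<n}"
    and "shift_invariant W"
    and "sufficiently_small m W"
  shows "\<exists>T. tournament_subroutine m L T \<and>
           F_discrete_OCS (\<lambda>n. \<integral>x. (\<Prod>l<n. (1 - x l)) \<partial>W) m L (OCS L W T)"
proof -
  interpret small_win_dist W m
    by unfold_locales (fact assms)+
  interpret na_win_dist W
    by unfold_locales (fact assms)+
  \<comment> \<open>\<open>V\<close> must be defined for every multiplicity. Outside the range of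
    the smallness hypothesis the constant score \<open>0\<close> is taken; this includes
    \<open>r = m\<close>, where the element has no opponent.\<close>
  have "\<exists>V. score_function V \<and> (1 \<le> r \<and> r < m \<longrightarrow> fair_score r V)" for r
  proof (cases "1 \<le> r \<and> r < m")
    case True
    then show ?thesis using fair_score_exists[of r] by blast
  next
    case False
    have "score_function (\<lambda>_ _. 0)" by (simp add: score_function_def)
    with False show ?thesis by blast
  qed
  then obtain V where V: "\<And>r. score_function (V r)" "\<And>r. 1 \<le> r \<Longrightarrow> r < m \<Longrightarrow> fair_score r (V r)"
    by metis
  interpret fair_contest V W m
  proof
    show "(\<lambda>(w, u). V r w u) \<in> borel_measurable (borel \<Otimes>\<^sub>M borel)" "V r w u \<in> {0..1}" for r w u
      using V(1)[of r] unfolding score_function_def by blast+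
    show "V r w u \<le> V r w' u" if "w \<le> w'" for r w w' u
      using V(1)[of r] that unfolding score_function_def by blast
    show "w \<le> (\<integral>u. V r w u ^ (m - r) \<partial>unif)" if "1 \<le> r" "r < m" "w \<in> {0..1}" for r w
      using V(2)[OF that(1,2)] that(3) unfolding fair_score_def by blast
    show "v ^ r \<le> (\<integral>x. measure unif {u. V r (win_prob r x) u < v} \<partial>W)"
      if "1 \<le> r" "r < m" "v \<in> {0..1}" for r v
      using V(2)[OF that(1,2)] that(3) unfolding fair_score_def by blast
  qed
  have ne: "A \<noteq> {#}" if "size A = m" for A :: "'i multiset" using that assms(1) by auto
  have tour: "tournament_subroutine m L contest"
    unfolding tournament_subroutine_def
  proof (intro allI impI conjI ballI; elim conjE)
    fix A :: "'i multiset" and w assume A: "size A = m"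
    show "set_pmf (contest A w) \<subseteq> set_mset A" by (rule set_pmf_contest[OF ne[OF A]])
  next
    fix A :: "'i multiset" and i assume A: "size A = m"
    show "(\<lambda>w. pmf (contest A w) i) \<in> borel_measurable (Pi\<^sub>M (set_mset A) (\<lambda>_. unit_interval))"
      by (rule contest_measurable[OF ne[OF A]])
        (rule measurable_unit_interval_borel, rule measurable_component_singleton)
  qed
  interpret tournament_OCS W m L contest
  proof
    fix A :: "'i multiset" and i and w w' :: "'i \<Rightarrow> real"
    assume "size A = m" "w i = w' i" "\<And>c. c \<in># A \<Longrightarrow> w c \<le> w' c"
    then show "pmf (contest A w') i \<le> pmf (contest A w) i"
      by (intro contest_antimono ne)
  qed (rule tour, rule contest_wins)
  show ?thesis using tour F_discrete_OCS by blast
qed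

end
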